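(* Let $T>0$, $b\in\mathbb{R}\setminus\{0\}$, let $\varphi:\mathbb{R}\to\mathbb{R}$ be a homeomorphism with $\varphi(0)=0$, and let $f:[0,T]\times\mathbb{R}\times\mathbb{R}\to\mathbb{R}$ be continuous. Assume that the following conditions hold for an opportune $\rho>0$. 1. There exists a function $h\in C$ such that $|f(t,x,y)|\le h(t)$ for all $(t,x,y)\in[0,T]\times\mathbb{R}^2$. 2. There exist $M_1<M_2$ such that for all $u\in C^1$, $$\int_0^T f(t,u(t),u'(t))\,dt-B_{\varphi,b}(u'(0))\neq 0\quad\text{if } \min_{[0,T]}u'\ge M_2,$$ $$\int_0^T f(t,u(t),u'(t))\,dt-B_{\varphi,b}(u'(0))\neq 0\quad\text{if } \max_{[0,T]}u'\le M_1.$$ 3. The Brouwer degree satisfies $\deg_B(G,B_\rho(0)\cap\mathbb{R}^2,0)\neq 0$. Then the problem $$(\varphi(u'))'=f(t,u,u'),\quad u'(0)=u(0),\quad u'(T)=bu'(0)$$ has at least one solution.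
   Context: $C=C([0,T],\mathbb{R})$ is the Banach space of continuous functions with the norm $\|\cdot\|_\infty$, and $C^1=C^1([0,T],\mathbb{R})$ is the Banach space of continuously differentiable functions with the norm $\|u\|_1=\|u\|_\infty+\|u'\|_\infty$. A solution is a function $u\in C^1$ such that $\varphi(u')$ is continuously differentiable, $(\varphi(u'(t)))'=f(t,u(t),u'(t))$ for all $t\in[0,T]$, and the boundary conditions hold. $B_{\varphi,b}(x)=\varphi(bx)-\varphi(x)$ for $x\in\mathbb{R}$. The map $G:\mathbb{R}^2\to\mathbb{R}^2$ is $$G(x,y)=\left(\frac{B_{\varphi,b}(x)}{T}-\frac1T\int_0^T f(t,x+yt,y)\,dt,\ -x+y\right).$$ $B_\rho(0)$ is the open ball of $C^1$ with center $0$ and radius $\rho$, and $\mathbb{R}^2$ is identified with the affine functions in $C^1$ via $(x,y)\approx x+yt$, so $B_\rho(0)\cap\mathbb{R}^2=\{(x,y): \max_{t\in[0,T]}|x+yt|+|y|<\rho\}$. $\deg_B$ denotes the Brouwer degree.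
   Formalization: "Opportune ρ" is read as: ρ>0 and B_ρ(0)∩R² contains all zeros of G (true for all ρ>(2+T)max(|M₁|,|M₂|)); for arbitrary ρ>0 the claim is false, since a small ball may isolate one zero of G although no solution exists. *)

theory Defs
  imports "HOL-Analysis.Analysis"
begin

section \<open>Brouwer degree\<close>

primrec Ck_fun :: "nat \<Rightarrow> (real ^ 'n \<Rightarrow> real) \<Rightarrow> bool" where
  "Ck_fun 0 g \<longleftrightarrow> continuous_on UNIV g"
| "Ck_fun (Suc k) g \<longleftrightarrow>
     (\<exists>D :: real ^ 'n \<Rightarrow> real ^ 'n.
        (\<forall>x. (g has_derivative (\<lambda>v. D x \<bullet> v)) (at x)) \<and> (\<forall>i. Ck_fun k (\<lambda>x. D x $ i)))"

definition smooth_map :: "(real ^ 'n \<Rightarrow> real ^ 'm) \<Rightarrow> bool" where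
  "smooth_map g \<longleftrightarrow> (\<forall>k i. Ck_fun k (\<lambda>x. g x $ i))"

text \<open>Smooth maps that are uniformly closer to \<open>f\<close> on the closure of \<open>\<Omega>\<close> than \<open>p\<close> is to the
  image of the boundary, and that have \<open>p\<close> as a regular value in \<open>\<Omega>\<close>.\<close>

definition regular_approx ::
  "(real ^ 'n \<Rightarrow> real ^ 'n) \<Rightarrow> (real ^ 'n) set \<Rightarrow> real ^ 'n \<Rightarrow> (real ^ 'n \<Rightarrow> real ^ 'n) \<Rightarrow> bool" where
  "regular_approx f \<Omega> p g \<longleftrightarrow>
     smooth_map g \<and>
     (\<forall>x\<in>closure \<Omega>. dist (g x) (f x) < infdist p (f ` frontier \<Omega>)) \<and>
     (\<forall>x\<in>\<Omega>. g x = p \<longrightarrow> det (jacobian g (at x)) \<noteq> 0)"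

text \<open>The analytic definition: \<open>deg(f, \<Omega>, p)\<close> is the signed number of preimages of \<open>p\<close> in \<open>\<Omega>\<close>
  under any regular approximation. Such approximations exist (Weierstrass and Sard) and all give
  the same count. Where the degree is not defined (in particular if \<open>p\<close> is attained on the
  boundary) the value is 0 by convention, so \<open>brouwer_degree f \<Omega> p \<noteq> 0\<close> includes the assertion
  that the degree is defined.\<close>

definition brouwer_degree ::
  "(real ^ 'n \<Rightarrow> real ^ 'n) \<Rightarrow> (real ^ 'n) set \<Rightarrow> real ^ 'n \<Rightarrow> int" where
  "brouwer_degree f \<Omega> p =
     (if open \<Omega> \<and> bounded \<Omega> \<and> continuous_on (closure \<Omega>) f \<and> p \<notin> f ` frontier \<Omega>
      then THE d. \<forall>g. regular_approx f \<Omega> p g \<longrightarrow>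
             real_of_int d = (\<Sum>x\<in>{x \<in> \<Omega>. g x = p}. sgn (det (jacobian g (at x))))
      else 0)"

section \<open>The space of continuously differentiable functions on a compact interval\<close>

text \<open>An element of \<open>C\<^sup>1[0,T]\<close> is represented by a function on all of the reals, of which only the
  values on \<open>[0,T]\<close> matter; derivatives at the endpoints are one-sided.\<close>

definition deriv_on :: "real \<Rightarrow> (real \<Rightarrow> real) \<Rightarrow> real \<Rightarrow> real" where
  "deriv_on T u t = vector_derivative u (at t within {0..T})"

definition C1 :: "real \<Rightarrow> (real \<Rightarrow> real) set" where
  "C1 T = {u. u differentiable_on {0..T} \<and> continuous_on {0..T} (deriv_on T u)}"

definition sup_norm :: "real \<Rightarrow> (real \<Rightarrow> real) \<Rightarrow> real" where
  "sup_norm T u = (SUP t\<in>{0..T}. \<bar>u t\<bar>)"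

definition C1_norm :: "real \<Rightarrow> (real \<Rightarrow> real) \<Rightarrow> real" where
  "C1_norm T u = sup_norm T u + sup_norm T (deriv_on T u)"

text \<open>\<open>B\<^sub>\<rho>(0) \<inter> \<real>\<^sup>2\<close>, where \<open>(x, y)\<close> is identified with the affine function \<open>x + y t\<close>.\<close>

definition affine_ball :: "real \<Rightarrow> real \<Rightarrow> (real ^ 2) set" where
  "affine_ball T \<rho> = {z. C1_norm T (\<lambda>t. z $ 1 + z $ 2 * t) < \<rho>}"

lemma affine_ball_eq:
  assumes "0 < T"
  shows "affine_ball T \<rho> = {z. (SUP t\<in>{0..T}. \<bar>z $ 1 + z $ 2 * t\<bar>) + \<bar>z $ 2\<bar> < \<rho>}"
proof -
  have "deriv_on T (\<lambda>t. z $ 1 + z $ 2 * t) t = z $ 2" if "t \<in> {0..T}" for z :: "real ^ 2" and t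
    unfolding deriv_on_def using assms that
    by (intro vector_derivative_within_cbox[where a = 0 and b = T, unfolded cbox_interval])
       (auto intro!: derivative_eq_intros simp: has_real_derivative_iff_has_vector_derivative[symmetric])
  then have "sup_norm T (deriv_on T (\<lambda>t. z $ 1 + z $ 2 * t)) = \<bar>z $ 2\<bar>" for z :: "real ^ 2"
    unfolding sup_norm_def using assms by (simp cong: SUP_cong_simp)
  then show ?thesis
    by (simp add: affine_ball_def C1_norm_def sup_norm_def)
qed

section \<open>The boundary value problem\<close>

definition B_map :: "(real \<Rightarrow> real) \<Rightarrow> real \<Rightarrow> real \<Rightarrow> real" where
  "B_map \<phi> b x = \<phi> (b * x) - \<phi> x"

definition G_map ::
  "real \<Rightarrow> real \<Rightarrow> (real \<Rightarrow> real) \<Rightarrow> (real \<Rightarrow> real \<Rightarrow> real \<Rightarrow> real) \<Rightarrow> real ^ 2 \<Rightarrow> real ^ 2" where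
  "G_map T b \<phi> f z =
     vector [B_map \<phi> b (z $ 1) / T - 1 / T * integral {0..T} (\<lambda>t. f t (z $ 1 + z $ 2 * t) (z $ 2)),
             - z $ 1 + z $ 2]"

definition is_solution ::
  "real \<Rightarrow> real \<Rightarrow> (real \<Rightarrow> real) \<Rightarrow> (real \<Rightarrow> real \<Rightarrow> real \<Rightarrow> real) \<Rightarrow> (real \<Rightarrow> real) \<Rightarrow> bool" where
  "is_solution T b \<phi> f u \<longleftrightarrow>
     u \<in> C1 T \<and> (\<lambda>t. \<phi> (deriv_on T u t)) \<in> C1 T \<and>
     (\<forall>t\<in>{0..T}. deriv_on T (\<lambda>s. \<phi> (deriv_on T u s)) t = f t (u t) (deriv_on T u t)) \<and>
     deriv_on T u 0 = u 0 \<and> deriv_on T u T = b * deriv_on T u 0"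

text \<open>The radius has to be large enough for the ball to contain every zero of \<open>G\<close>. If
  \<open>\<integral> f(t, u, u') dt - B(u'(0))\<close> does not vanish for \<open>u' \<ge> M\<^sub>2\<close> nor for \<open>u' \<le> M\<^sub>1\<close>, then all zeros
  are of the form \<open>(x, x)\<close> with \<open>M\<^sub>1 < x < M\<^sub>2\<close>, so the requirement is met by every
  \<open>\<rho> > (2 + T) max(|M\<^sub>1|, |M\<^sub>2|)\<close>. It cannot be dropped: a small ball may isolate one of two
  zeros of opposite index, giving degree \<open>\<plusminus>1\<close> although the problem has no solution.\<close>

definition opportune_radius ::
  "real \<Rightarrow> real \<Rightarrow> (real \<Rightarrow> real) \<Rightarrow> (real \<Rightarrow> real \<Rightarrow> real \<Rightarrow> real) \<Rightarrow> real \<Rightarrow> bool" where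
  "opportune_radius T b \<phi> f \<rho> \<longleftrightarrow> 0 < \<rho> \<and> {z. G_map T b \<phi> f z = 0} \<subseteq> affine_ball T \<rho>"

end

theory Submission
  imports Defs "HOL-Complex_Analysis.Great_Picard"
begin

text \<open>On the line \<open>y = x\<close> the first component of \<open>G\<close> is, up to a negative factor, the functional
  \<open>\<integral> f(t, u, u') dt - B(u'(0))\<close> evaluated at the affine function \<open>u(t) = x + x t\<close>. If this functional had
  the same sign at the affine functions of slopes \<open>M\<^sub>1\<close> and \<open>M\<^sub>2\<close>, then \<open>G\<close> would avoid a half-line
  from the origin on the boundary of the ball, so its winding number there, and hence its degree, would
  be zero. Thus the functional takes opposite signs on the convex sets \<open>u' \<le> M\<^sub>1\<close> and \<open>u' \<ge> M\<^sub>2\<close>. Since \<open>f\<close> is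
  bounded and \<open>\<phi>\<close> is coercive, solutions of the initial value problem \<open>u(0) = u'(0) = x\<close> lie in these
  sets for \<open>x\<close> very negative and very positive, respectively. As the initial value problem need not be
  uniquely solvable, it is replaced by one with a small delay, whose solution depends continuously
  on \<open>x\<close>; the intermediate value theorem gives a zero of the functional, and letting the delay tend
  to zero gives a solution of \<open>u'(T) = b u'(0)\<close>.\<close>

section \<open>A vanishing criterion for the planar Brouwer degree\<close>

definition cplx :: "real ^ 2 \<Rightarrow> complex" where
  "cplx v = Complex (v $ 1) (v $ 2)"

lemma linear_cplx: "linear cplx"
  by (rule linearI) (simp_all add: cplx_def complex_eq_iff)

lemma norm_cplx [simp]: "norm (cplx v) = norm v"
  by (simp add: cplx_def norm_complex_def norm_vec_def L2_set_def sum_2)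

lemma cplx_0 [simp]: "cplx 0 = 0"
  by (metis norm_cplx norm_eq_zero)

lemma cplx_eq_0_iff [simp]: "cplx v = 0 \<longleftrightarrow> v = 0"
  by (metis norm_cplx norm_eq_zero)

lemma cplx_diff: "cplx (v - w) = cplx v - cplx w"
  by (rule linear_diff[OF linear_cplx])

lemma continuous_on_cplx [continuous_intros]:
  "continuous_on S g \<Longrightarrow> continuous_on S (\<lambda>x. cplx (g x))"
  by (rule bounded_linear.continuous_on[OF linear_conv_bounded_linear[THEN iffD1, OF linear_cplx]])

text \<open>A model zero at \<open>z\<close> of index 1 or -1, since conjugation reverses
  orientation. In the application \<open>s\<close> records whether the Jacobian determinant at
  \<open>z\<close> is positive.\<close>

definition simple_factor :: "bool \<Rightarrow> real ^ 2 \<Rightarrow> real ^ 2 \<Rightarrow> complex" where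
  "simple_factor s z w = (if s then cplx (w - z) else cnj (cplx (w - z)))"

lemma norm_simple_factor [simp]: "norm (simple_factor s z w) = norm (w - z)"
  by (simp add: simple_factor_def)

lemma simple_factor_eq_0_iff [simp]: "simple_factor s z w = 0 \<longleftrightarrow> w = z"
  by (simp add: simple_factor_def)

lemma continuous_on_simple_factor [continuous_intros]:
  "continuous_on S (simple_factor s z)"
  unfolding simple_factor_def by (cases s) (auto intro!: continuous_intros)

text \<open>\<open>\<alpha>\<close> and \<open>\<beta>\<close> are the Wirtinger coefficients of the
  matrix; the formula for the determinant lets its sign decide which of them dominates.\<close>

lemma cplx_matrix_vector:
  fixes A :: "real ^ 2 ^ 2"
  obtains \<alpha> \<beta> where "\<And>v. cplx (A *v v) = \<alpha> * cplx v + \<beta> * cnj (cplx v)"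
    and "det A = (norm \<alpha>)\<^sup>2 - (norm \<beta>)\<^sup>2"
proof
  let ?\<alpha> = "Complex ((A$1$1 + A$2$2) / 2) ((A$2$1 - A$1$2) / 2)"
  let ?\<beta> = "Complex ((A$1$1 - A$2$2) / 2) ((A$2$1 + A$1$2) / 2)"
  show "cplx (A *v v) = ?\<alpha> * cplx v + ?\<beta> * cnj (cplx v)" for v
    by (simp add: cplx_def complex_eq_iff matrix_vector_mult_def sum_2 field_simps)
  show "det A = (norm ?\<alpha>)\<^sup>2 - (norm ?\<beta>)\<^sup>2"
    unfolding cmod_power2 by (simp add: det_2 power2_eq_square field_simps)
qed

text \<open>The witness \<open>\<alpha>\<close> is the coefficient of the dominating one of the linear and the antilinear part
  of the derivative.\<close>

lemma regular_zero_factor: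
  fixes g :: "real ^ 2 \<Rightarrow> real ^ 2"
  assumes g: "g differentiable (at z)" "g z = 0" and det: "det (jacobian g (at z)) \<noteq> 0"
  shows "\<exists>\<alpha>. \<exists>r>0. \<forall>w. 0 < norm (w - z) \<and> norm (w - z) \<le> r \<longrightarrow>
    norm (cplx (g w) / simple_factor (det (jacobian g (at z)) > 0) z w - \<alpha>) < norm \<alpha>"
proof -
  let ?A = "jacobian g (at z)"
  obtain \<alpha> \<beta> where ab: "\<And>v. cplx (?A *v v) = \<alpha> * cplx v + \<beta> * cnj (cplx v)"
    and det_ab: "det ?A = (norm \<alpha>)\<^sup>2 - (norm \<beta>)\<^sup>2"
    using cplx_matrix_vector by blast
  define s where "s = (det ?A > 0)"
  define p where "p = (if s then \<alpha> else \<beta>)"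
  define q where "q = (if s then \<beta> else \<alpha>)"
  have "(norm q)\<^sup>2 < (norm p)\<^sup>2"
  proof (cases s)
    case False
    then have "det ?A < 0" using det unfolding s_def by linarith
    then show ?thesis using False unfolding det_ab by (simp add: p_def q_def)
  qed (use det_ab in \<open>simp add: p_def q_def s_def\<close>)
  then have qp: "norm q < norm p"
    using power_less_imp_less_base by fastforce
  have ab': "cplx (?A *v v) = p * (if s then cplx v else cnj (cplx v)) + q * (if s then cnj (cplx v) else cplx v)" for v
    by (simp add: ab p_def q_def)
  \<comment> \<open>With half the gap as error rate, the remainder and the subordinate part together
    stay below \<open>norm p * norm ?v\<close>.\<close>
  define e where "e = (norm p - norm q) / 2"
  have "e > 0" using qp by (simp add: e_def)
  have "(g has_derivative (\<lambda>h. ?A *v h)) (at z)"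
    using g jacobian_works by blast
  then obtain d where "d > 0"
    and d: "\<And>w. norm (w - z) < d \<Longrightarrow> norm (g w - g z - ?A *v (w - z)) \<le> e * norm (w - z)"
    unfolding has_derivative_at_alt using \<open>e > 0\<close> by blast
  show ?thesis
  proof (intro exI[of _ p] exI[of _ "d / 2"] conjI allI impI)
    show "0 < d / 2" using \<open>d > 0\<close> by simp
    fix w assume w: "0 < norm (w - z) \<and> norm (w - z) \<le> d / 2"
    let ?v = "w - z"
    let ?f = "simple_factor s z w"
    have f0: "?f \<noteq> 0" using w by auto
    have f: "?f = (if s then cplx ?v else cnj (cplx ?v))" by (simp add: simple_factor_def)
    have "cplx (g w) - p * ?f = cplx (g w - ?A *v ?v) + q * (if s then cnj (cplx ?v) else cplx ?v)"
      unfolding cplx_diff[of "g w"] ab' f by simp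
    moreover have "norm (g w - ?A *v ?v) \<le> e * norm ?v"
      using d[of w] w \<open>d > 0\<close> g(2) by simp
    ultimately have "norm (cplx (g w) - p * ?f) \<le> e * norm ?v + norm q * norm ?v"
      by (smt (verit) complex_mod_cnj norm_cplx norm_mult norm_triangle_ineq)
    also have "\<dots> < norm p * norm ?v"
      unfolding distrib_right[symmetric]
      using w qp by (intro mult_strict_right_mono) (auto simp: e_def field_simps)
    finally have "norm (cplx (g w) - p * ?f) < norm p * norm ?f" by simp
    moreover have "cplx (g w) / ?f - p = (cplx (g w) - p * ?f) / ?f"
      using f0 by (simp add: field_simps)
    ultimately show "norm (cplx (g w) / simple_factor (det ?A > 0) z w - p) < norm p"
      using f0 by (simp add: norm_divide divide_less_eq flip: s_def)
  qed
qed

text \<open>The bare quotient may have different limits at \<open>z\<close> along different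
  directions. The real factor removes this, because the product is bounded by
  \<open>norm (F w)\<close>, which tends to 0 at \<open>z\<close>.\<close>

lemma continuous_on_interpolation:
  fixes F :: "real ^ 2 \<Rightarrow> complex"
  assumes "continuous_on S F" and "F z = 0"
  shows "continuous_on S (\<lambda>w. of_real (norm (w - z)) * (F w / simple_factor s z w))"
  unfolding continuous_on_def
proof
  fix x assume "x \<in> S"
  show "((\<lambda>w. of_real (norm (w - z)) * (F w / simple_factor s z w)) \<longlongrightarrow>
      of_real (norm (x - z)) * (F x / simple_factor s z x)) (at x within S)"
  proof (cases "x = z")
    case True
    have "(F \<longlongrightarrow> 0) (at x within S)"
      using assms True \<open>x \<in> S\<close> by (metis continuous_on_def)
    then have "((\<lambda>w. of_real (norm (w - z)) * (F w / simple_factor s z w)) \<longlongrightarrow> 0) (at x within S)"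
      by (rule Lim_null_comparison[OF _ tendsto_norm_zero, rotated])
        (auto simp: norm_mult norm_divide intro!: always_eventually)
    then show ?thesis using True by simp
  next
    case False
    have "(F \<longlongrightarrow> F x) (at x within S)"
      using assms \<open>x \<in> S\<close> by (metis continuous_on_def)
    moreover have "(simple_factor s z \<longlongrightarrow> simple_factor s z x) (at x within S)"
      using continuous_on_simple_factor[of S s z] \<open>x \<in> S\<close> by (metis continuous_on_def)
    ultimately show ?thesis using False by (auto intro!: tendsto_intros)
  qed
qed

text \<open>On the disc around a zero \<open>z\<close>, the quotient by the factor of \<open>z\<close> is interpolated with the constant
  \<open>\<alpha> z\<close>. The quotient stays in an open half-plane containing \<open>\<alpha> z\<close>, so no new zeros arise.\<close>

lemma divide_out_zeros:
  fixes F :: "real ^ 2 \<Rightarrow> complex" and s :: "real ^ 2 \<Rightarrow> bool"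
  assumes F: "continuous_on X F" and Z: "{x \<in> X. F x = 0} = Z"
    and "finite Y" "Y \<subseteq> Z" and r: "0 < r" "closed X"
    and sub: "\<And>z. z \<in> Z \<Longrightarrow> cball z r \<subseteq> X"
    and disj: "\<And>z z'. z \<in> Z \<Longrightarrow> z' \<in> Z \<Longrightarrow> z \<noteq> z' \<Longrightarrow> cball z r \<inter> cball z' r = {}"
    and \<alpha>: "\<And>z w. z \<in> Z \<Longrightarrow> 0 < norm (w - z) \<Longrightarrow> norm (w - z) \<le> r \<Longrightarrow>
      norm (F w / simple_factor (s z) z w - \<alpha> z) < norm (\<alpha> z)"
    and \<alpha>0: "\<And>z. z \<in> Z \<Longrightarrow> \<alpha> z \<noteq> 0"
  shows "\<exists>Q. continuous_on X Q \<and> (\<forall>w \<in> X - (Z - Y). Q w \<noteq> 0) \<and>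
    (\<forall>w \<in> X - (\<Union>z\<in>Y. ball z r). Q w * (\<Prod>z\<in>Y. simple_factor (s z) z w) = F w)"
  using \<open>finite Y\<close> \<open>Y \<subseteq> Z\<close>
proof (induction Y)
  case empty
  show ?case using F Z by (intro exI[of _ F]) auto
next
  \<comment> \<open>The zeros are divided out one at a time; \<open>Q\<close> may still vanish on
    \<open>Z - Y\<close>.\<close>
  case (insert z Y)
  then obtain Q where Q: "continuous_on X Q" "\<And>w. w \<in> X - (Z - Y) \<Longrightarrow> Q w \<noteq> 0"
    and QF: "\<And>w. w \<in> X - (\<Union>z\<in>Y. ball z r) \<Longrightarrow> Q w * (\<Prod>z\<in>Y. simple_factor (s z) z w) = F w"
    by blast
  let ?P = "\<lambda>w. \<Prod>z\<in>Y. simple_factor (s z) z w"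
  let ?p = "simple_factor (s z) z"
  \<comment> \<open>A convex interpolation with weight \<open>norm (w - z) / r\<close>: it equals
    \<open>\<alpha> z\<close> at the centre and \<open>F w / ?p w\<close> on the bounding
    circle.\<close>
  define E where "E = (\<lambda>w. \<alpha> z * (1 - of_real (norm (w - z)) / r) + of_real (norm (w - z)) * (F w / ?p w) / r)"
  \<comment> \<open>Division by \<open>?P\<close> makes the two branches agree on the circle: there
    \<open>Q\<close> equals \<open>F / ?P\<close>, because the closed disc around \<open>z\<close>
    misses the balls around \<open>Y\<close>.\<close>
  define Q' where "Q' = (\<lambda>w. if w \<in> cball z r then E w / ?P w else Q w / ?p w)"
  have zZ: "z \<in> Z" using insert by auto
  have zX: "z \<in> X" "F z = 0" using zZ Z by auto
  have notY: "w \<notin> ball y r" "w \<noteq> y" if "w \<in> cball z r" "y \<in> Y" for w y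
  proof -
    have "cball z r \<inter> cball y r = {}" using that insert zZ by (intro disj) auto
    then show "w \<notin> ball y r" "w \<noteq> y" using that r by auto
  qed
  have P0: "?P w \<noteq> 0" if "w \<in> cball z r" for w
    using notY(2)[OF that] insert(1) by (auto simp: prod_zero_iff)
  have E_F: "E w = F w / ?p w" if "norm (w - z) = r" for w
    using that r by (simp add: E_def)
  have E0: "E w \<noteq> 0" if "w \<in> cball z r" for w
  proof (cases "w = z")
    case True then show ?thesis using \<alpha>0[OF zZ] by (simp add: E_def)
  next
    case False
    define t where "t = norm (w - z) / r"
    have t: "0 \<le> t" "t \<le> 1" "0 < norm (w - z)" "norm (w - z) \<le> r"
      using that r False by (auto simp: t_def dist_norm norm_minus_commute)
    have "E w = \<alpha> z + of_real t * (F w / ?p w - \<alpha> z)"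
      by (simp add: E_def t_def algebra_simps)
    moreover have "norm (of_real t * (F w / ?p w - \<alpha> z)) < norm (\<alpha> z)"
    proof -
      have "norm (of_real t * (F w / ?p w - \<alpha> z)) \<le> 1 * norm (F w / ?p w - \<alpha> z)"
        unfolding norm_mult using t by (intro mult_right_mono) auto
      then show ?thesis using \<alpha>[OF zZ t(3,4)] by simp
    qed
    ultimately show ?thesis by (metis add_eq_0_iff norm_minus_cancel order_less_irrefl)
  qed
  have "continuous_on (cball z r \<union> (X - ball z r)) Q'"
    unfolding Q'_def
  proof (rule continuous_on_If)
    show "closed (cball z r)" "closed (X - ball z r)" using \<open>closed X\<close> by auto
    have "continuous_on (cball z r) F" using F sub[OF zZ] continuous_on_subset by blast
    then show "continuous_on (cball z r) (\<lambda>w. E w / ?P w)"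
      unfolding E_def using P0 zX
      by (intro continuous_intros continuous_on_interpolation) (use r in auto)
    show "continuous_on (X - ball z r) (\<lambda>w. Q w / ?p w)"
      using r Q(1) by (intro continuous_intros) (auto intro: continuous_on_subset)
  next
    fix w assume "w \<in> cball z r" "\<not> w \<in> cball z r"
    then show "E w / ?P w = Q w / ?p w" by blast
  next
    fix w assume w: "w \<in> X - ball z r" "w \<in> cball z r"
    then have nw: "norm (w - z) = r" by (auto simp: dist_norm norm_minus_commute)
    have "Q w * ?P w = F w" using w notY(1)[OF w(2)] by (intro QF) auto
    then have "Q w = F w / ?P w" using P0[OF w(2)] by (simp add: field_simps)
    then show "E w / ?P w = Q w / ?p w" by (simp add: E_F[OF nw])
  qed
  moreover have "cball z r \<union> (X - ball z r) = X" using sub[OF zZ] by auto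
  moreover have "Q' w \<noteq> 0" if "w \<in> X - (Z - insert z Y)" for w
    using that E0 P0 Q(2)[of w] r by (auto simp: Q'_def)
  moreover have "Q' w * (\<Prod>z\<in>insert z Y. simple_factor (s z) z w) = F w"
    if w: "w \<in> X - (\<Union>z\<in>insert z Y. ball z r)" for w
  proof -
    have p0: "?p w \<noteq> 0" using w r by auto
    have "Q' w * ?p w * ?P w = F w"
    proof (cases "w \<in> cball z r")
      case True
      then have "norm (w - z) = r" using w by (auto simp: dist_norm norm_minus_commute)
      then have "Q' w = F w / ?p w / ?P w" using E_F True by (simp add: Q'_def)
      then show ?thesis using P0[OF True] p0 by simp
    next
      case False
      then show ?thesis using QF[of w] w p0 by (simp add: Q'_def)
    qed
    then show ?thesis using insert by (simp add: mult.assoc)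
  qed
  ultimately show ?case by (intro exI[of _ Q']) auto
qed

text \<open>On a circle enclosing \<open>Z\<close> each factor winds once around 0, in the direction
  given by \<open>s z\<close>. A continuous logarithm of the product on that circle forces the total
  winding number to vanish.\<close>

lemma prod_simple_factors_exp:
  fixes s :: "real ^ 2 \<Rightarrow> bool" and N :: "real ^ 2 \<Rightarrow> complex"
  assumes "finite Z" and Z: "\<And>z. z \<in> Z \<Longrightarrow> norm z < R"
    and N: "continuous_on (sphere 0 R) N"
    and eq: "\<And>w. norm w = R \<Longrightarrow> (\<Prod>z\<in>Z. simple_factor (s z) z w) = exp (N w)"
  shows "(\<Sum>z\<in>Z. if s z then 1 else - 1 :: real) = 0"
proof (cases "Z = {}")
  case False
  then have "R > 0" using Z norm_ge_zero by (metis ex_in_conv order_le_less_trans)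
  define \<gamma> :: "real \<Rightarrow> real ^ 2" where "\<gamma> t = (R * cos t) *\<^sub>R axis 1 1 + (R * sin t) *\<^sub>R axis 2 1" for t
  have \<gamma>_cplx: "cplx (\<gamma> t) = R * exp (\<i> * t)" for t
    by (simp add: \<gamma>_def cplx_def axis_def complex_eq_iff Re_exp Im_exp)
  have norm_\<gamma>: "norm (\<gamma> t) = R" for t
    using \<open>R > 0\<close> by (simp flip: norm_cplx add: \<gamma>_cplx norm_mult)
  have cont_\<gamma>: "continuous_on UNIV \<gamma>"
    unfolding \<gamma>_def by (intro continuous_intros)
  \<comment> \<open>An explicit lift: \<open>cplx (\<gamma> t - z)\<close> is
    \<open>R * exp (\<i> * t)\<close> times a factor in the right half-plane, where the principal
    logarithm is continuous. Over one period only the term \<open>\<i> * t\<close> contributes an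
    increment.\<close>
  define l where "l z t = of_real (ln R) + \<i> * t + Ln (1 - cplx z * exp (- (\<i> * t)) / R)" for z and t :: real
  have small: "norm (cplx z * exp (- (\<i> * of_real t)) / R) < 1" if "z \<in> Z" for z t
    using Z[OF that] \<open>R > 0\<close> by (simp add: norm_mult norm_divide)
  have pos: "Re (1 - cplx z * exp (- (\<i> * of_real t)) / R) > 0" if "z \<in> Z" for z t
    using small[OF that, of t] complex_Re_le_cmod[of "cplx z * exp (- (\<i> * of_real t)) / R"] by simp
  have exp_l: "exp (l z t) = cplx (\<gamma> t - z)" if "z \<in> Z" for z t
  proof -
    have "1 - cplx z * exp (- (\<i> * of_real t)) / R \<noteq> 0"
      using pos[OF that, of t] by (metis less_irrefl zero_complex.sel(1))
    then have "exp (l z t) = R * exp (\<i> * t) * (1 - cplx z * exp (- (\<i> * t)) / R)"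
      using \<open>R > 0\<close> by (simp add: l_def exp_add exp_of_real)
    also have "\<dots> = R * exp (\<i> * t) - cplx z"
      using \<open>R > 0\<close> by (simp add: field_simps exp_minus)
    finally show ?thesis by (simp add: cplx_diff \<gamma>_cplx)
  qed
  have cont_l: "continuous_on UNIV (l z)" if "z \<in> Z" for z
  proof -
    have "1 - cplx z * exp (- (\<i> * of_real t)) / R \<notin> \<real>\<^sub>\<le>\<^sub>0" for t
      using pos[OF that, of t] unfolding complex_nonpos_Reals_iff by linarith
    then show ?thesis
      unfolding l_def using \<open>R > 0\<close> by (intro continuous_intros) simp_all
  qed
  have diff_l: "l z (2 * pi) - l z 0 = 2 * pi * \<i>" for z
  proof -
    have "exp (- (\<i> * of_real (2 * pi))) = (1 :: complex)"
      using exp_two_pi_i' by (simp add: exp_minus mult.commute)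
    then show ?thesis by (simp add: l_def)
  qed
  define m where "m z t = (if s z then l z t else cnj (l z t))" for z t
  have exp_m: "exp (m z t) = simple_factor (s z) z (\<gamma> t)" if "z \<in> Z" for z t
    using exp_l[OF that] by (auto simp: m_def simple_factor_def simp flip: exp_cnj)
  have cont_m: "continuous_on UNIV (m z)" if "z \<in> Z" for z
    unfolding m_def using cont_l[OF that] by (cases "s z") (auto intro!: continuous_intros)
  have diff_m: "m z (2 * pi) - m z 0 = (if s z then 1 else - 1) * (2 * pi * \<i>)" for z
    using diff_l[of z] by (auto simp: m_def simp flip: complex_cnj_diff)
  \<comment> \<open>All values of \<open>D\<close> are integer multiples of
    \<open>2 * pi * \<i>\<close>, so continuity makes \<open>D\<close> constant. As
    \<open>\<gamma>\<close> is closed, \<open>N\<close> cancels between 0 and \<open>2 * pi\<close>,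
    leaving the sum of the increments.\<close>
  define D where "D t = N (\<gamma> t) - (\<Sum>z\<in>Z. m z t)" for t
  have exp_D: "exp (D t) = 1" for t
    using eq[OF norm_\<gamma>[of t]] \<open>finite Z\<close>
    by (simp add: D_def exp_diff exp_sum exp_m)
  have "continuous_on UNIV (\<lambda>t. N (\<gamma> t))"
    by (rule continuous_on_compose2[OF N cont_\<gamma>]) (use norm_\<gamma> in auto)
  then have "continuous_on UNIV D"
    unfolding D_def using cont_m by (intro continuous_intros)
  moreover have "2 * pi \<le> norm (D y - D x)" if ne: "D y \<noteq> D x" for x y
  proof -
    obtain n :: int where n: "D y = D x + (of_int (2 * n) * pi) * \<i>"
      using exp_D[of x] exp_D[of y] exp_eq[of "D y" "D x"] by auto
    then have "n \<noteq> 0" using ne by auto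
    then have "1 \<le> \<bar>real_of_int n\<bar>" by linarith
    then have "2 * pi * 1 \<le> 2 * pi * \<bar>real_of_int n\<bar>" by (intro mult_left_mono) auto
    moreover have "norm (D y - D x) = 2 * pi * \<bar>real_of_int n\<bar>"
      using n by (simp add: norm_mult)
    ultimately show ?thesis by simp
  qed
  then have "\<exists>e>0. \<forall>y. y \<in> UNIV \<and> D y \<noteq> D x \<longrightarrow> e \<le> norm (D y - D x)" for x
    by (intro exI[of _ "2 * pi"]) auto
  ultimately have "D constant_on UNIV"
    by (intro continuous_discrete_range_constant connected_UNIV) auto
  then have "D (2 * pi) = D 0" by (metis UNIV_I constant_on_def)
  moreover have "\<gamma> (2 * pi) = \<gamma> 0" by (simp add: \<gamma>_def)
  ultimately have "(\<Sum>z\<in>Z. m z (2 * pi) - m z 0) = 0"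
    by (simp add: D_def sum_subtractf)
  then have "(\<Sum>z\<in>Z. if s z then 1 else - 1) * (2 * pi * \<i>) = 0"
    unfolding diff_m sum_distrib_right .
  then have "of_real (\<Sum>z\<in>Z. if s z then 1 else - 1) = (0 :: complex)"
    by (simp add: of_real_sum if_distrib cong: if_cong)
  then show ?thesis using of_real_eq_0_iff by blast
qed simp

text \<open>\<open>Q\<close> inside \<open>\<Omega>\<close> and \<open>exp L\<close> divided by the factors outside \<open>\<Omega>\<close> glue to a nonvanishing function on
  the plane. It has a logarithm, hence so has the product of the factors on a large circle.\<close>

lemma signed_zero_count_eq_0:
  fixes g :: "real ^ 2 \<Rightarrow> real ^ 2"
  assumes \<Omega>: "open \<Omega>" "bounded \<Omega>" and g: "continuous_on (closure \<Omega>) g"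
    and reg: "\<And>x. x \<in> \<Omega> \<Longrightarrow> g x = 0 \<Longrightarrow> g differentiable (at x) \<and> det (jacobian g (at x)) \<noteq> 0"
    and L: "continuous_on (frontier \<Omega>) L" "\<And>x. x \<in> frontier \<Omega> \<Longrightarrow> cplx (g x) = exp (L x)"
  shows "(\<Sum>x\<in>{x \<in> \<Omega>. g x = 0}. sgn (det (jacobian g (at x)))) = 0"
proof (cases "finite {x \<in> \<Omega>. g x = 0}")
  \<comment> \<open>Over an infinite set the sum is 0 by convention, so only the finite case has
    content.\<close>
  case True
  define Z where "Z = {x \<in> \<Omega>. g x = 0}"
  define s where "s z \<longleftrightarrow> det (jacobian g (at z)) > 0" for z
  define F where "F x = cplx (g x)" for x
  have "finite Z" using True by (simp add: Z_def)
  have F: "continuous_on (closure \<Omega>) F" unfolding F_def by (intro continuous_intros g)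
  have F0: "F x \<noteq> 0" if "x \<in> frontier \<Omega>" for x using L(2)[OF that] by (simp add: F_def)
  have closure: "closure \<Omega> = \<Omega> \<union> frontier \<Omega>" by (simp add: closure_Un_frontier)
  have Z: "{x \<in> closure \<Omega>. F x = 0} = Z"
    using F0 by (auto simp: closure Z_def) (auto simp: F_def)
  have "\<forall>z\<in>Z. \<exists>\<alpha>. \<exists>r>0. \<forall>w. 0 < norm (w - z) \<and> norm (w - z) \<le> r \<longrightarrow>
    norm (F w / simple_factor (s z) z w - \<alpha>) < norm \<alpha>"
    unfolding F_def s_def by (intro ballI regular_zero_factor) (use reg in \<open>auto simp: Z_def\<close>)
  then obtain \<alpha> r0 where r0: "\<And>z. z \<in> Z \<Longrightarrow> r0 z > 0"
    and \<alpha>: "\<And>z w. z \<in> Z \<Longrightarrow> 0 < norm (w - z) \<Longrightarrow> norm (w - z) \<le> r0 z \<Longrightarrow>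
      norm (F w / simple_factor (s z) z w - \<alpha> z) < norm (\<alpha> z)"
    by metis
  \<comment> \<open>Each condition holds for all small radii and there are finitely many, so one
    radius serves all zeros: the estimates hold, the closed discs lie in \<open>\<Omega>\<close> and
    they are disjoint.\<close>
  have "\<forall>\<^sub>F r in at_right (0 :: real). \<forall>z\<in>Z. r \<le> r0 z \<and> cball z r \<subseteq> \<Omega> \<and> (\<forall>z'\<in>Z. z \<noteq> z' \<longrightarrow> 2 * r < dist z z')"
  proof (intro eventually_ball_finite ballI \<open>finite Z\<close> eventually_conj)
    fix z assume z: "z \<in> Z"
    show "\<forall>\<^sub>F r in at_right (0 :: real). r \<le> r0 z"
      using r0[OF z] eventually_at_right_less[of "0::real"] by (auto simp: eventually_at_right_field intro!: exI[of _ "r0 z"])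
    obtain e where "e > 0" "cball z e \<subseteq> \<Omega>"
      using \<Omega>(1) z unfolding Z_def open_contains_cball by blast
    then show "\<forall>\<^sub>F r in at_right (0 :: real). cball z r \<subseteq> \<Omega>"
      unfolding eventually_at_right_field by (intro exI[of _ e]) fastforce
    show "\<forall>\<^sub>F r in at_right (0 :: real). z \<noteq> z' \<longrightarrow> 2 * r < dist z z'" for z'
      unfolding eventually_at_right_field
      by (rule exI[of _ "if z = z' then 1 else dist z z' / 2"]) auto
  qed
  then obtain b where "b > 0" and b: "\<And>r. 0 < r \<Longrightarrow> r < b \<Longrightarrow>
      \<forall>z\<in>Z. r \<le> r0 z \<and> cball z r \<subseteq> \<Omega> \<and> (\<forall>z'\<in>Z. z \<noteq> z' \<longrightarrow> 2 * r < dist z z')"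
    unfolding eventually_at_right_field by blast
  define r where "r = b / 2"
  have "r > 0" and r: "\<And>z. z \<in> Z \<Longrightarrow> r \<le> r0 z" "\<And>z. z \<in> Z \<Longrightarrow> cball z r \<subseteq> \<Omega>"
      "\<And>z z'. z \<in> Z \<Longrightarrow> z' \<in> Z \<Longrightarrow> z \<noteq> z' \<Longrightarrow> 2 * r < dist z z'"
    using b[of r] \<open>b > 0\<close> by (auto simp: r_def)
  let ?P = "\<lambda>w. \<Prod>z\<in>Z. simple_factor (s z) z w"
  have "\<exists>Q. continuous_on (closure \<Omega>) Q \<and> (\<forall>w \<in> closure \<Omega> - (Z - Z). Q w \<noteq> 0) \<and>
    (\<forall>w \<in> closure \<Omega> - (\<Union>z\<in>Z. ball z r). Q w * ?P w = F w)"
  proof (rule divide_out_zeros[OF F Z \<open>finite Z\<close> order_refl \<open>r > 0\<close> closed_closure, where \<alpha> = \<alpha>])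
    show "cball z r \<subseteq> closure \<Omega>" if "z \<in> Z" for z
      using r(2)[OF that] closure_subset by blast
    show "cball z r \<inter> cball z' r = {}" if z: "z \<in> Z" "z' \<in> Z" "z \<noteq> z'" for z z'
    proof -
      have "\<not> (dist z w \<le> r \<and> dist z' w \<le> r)" for w
        using r(3)[OF z] dist_triangle2[of z z' w] by linarith
      then show ?thesis by auto
    qed
    show "norm (F w / simple_factor (s z) z w - \<alpha> z) < norm (\<alpha> z)"
      if "z \<in> Z" "0 < norm (w - z)" "norm (w - z) \<le> r" for z w
      using \<alpha>[OF that(1,2)] r(1)[OF that(1)] that(3) by simp
    show "\<alpha> z \<noteq> 0" if "z \<in> Z" for z
    proof -
      \<comment> \<open>Any point of the circle will do: the strict estimate there would bound a
        norm strictly by 0 if \<open>\<alpha> z\<close> were 0.\<close>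
      let ?w = "z + r *\<^sub>R axis 1 1"
      have "norm (?w - z) = r" using \<open>r > 0\<close> by simp
      then have "norm (F ?w / simple_factor (s z) z ?w - \<alpha> z) < norm (\<alpha> z)"
        using \<alpha>[OF that, of ?w] r(1)[OF that] \<open>r > 0\<close> by linarith
      then show ?thesis by auto
    qed
  qed
  then obtain Q where Q: "continuous_on (closure \<Omega>) Q" "\<And>w. w \<in> closure \<Omega> \<Longrightarrow> Q w \<noteq> 0"
    and QF: "\<And>w. w \<in> closure \<Omega> - (\<Union>z\<in>Z. ball z r) \<Longrightarrow> Q w * ?P w = F w"
    by auto
  have P0: "?P w \<noteq> 0" if "w \<notin> \<Omega>" for w
    using that \<open>finite Z\<close> by (auto simp: prod_zero_iff Z_def)
  \<comment> \<open>Extending the logarithm instead of \<open>g\<close> keeps the extension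
    \<open>exp (L' w)\<close> free of zeros.\<close>
  obtain L' where L': "continuous_on UNIV L'" "\<And>x. x \<in> frontier \<Omega> \<Longrightarrow> L' x = L x"
    using Tietze_unbounded[OF L(1), of UNIV] by auto
  define H where "H w = (if w \<in> closure \<Omega> then Q w else exp (L' w) / ?P w)" for w
  have "continuous_on (closure \<Omega> \<union> - \<Omega>) H"
    unfolding H_def
  proof (rule continuous_on_If)
    show "continuous_on (- \<Omega>) (\<lambda>w. exp (L' w) / ?P w)"
      using P0 by (intro continuous_intros continuous_on_subset[OF L'(1)]) auto
    fix w assume w: "w \<in> - \<Omega>" "w \<in> closure \<Omega>"
    then have fr: "w \<in> frontier \<Omega>" using closure by auto
    have "w \<notin> ball z r" if "z \<in> Z" for z using r(2)[OF that] w(1) ball_subset_cball by blast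
    then have "Q w * ?P w = exp (L' w)" using QF[of w] w L(2) L'(2) fr by (auto simp: F_def)
    then show "Q w = exp (L' w) / ?P w" using P0[of w] w by (simp add: field_simps)
  qed (use Q \<Omega> in auto)
  moreover have "closure \<Omega> \<union> - \<Omega> = UNIV" using closure_subset by blast
  moreover have "H w \<noteq> 0" for w
    using Q(2) P0[of w] closure_subset[of \<Omega>] by (auto simp: H_def)
  ultimately obtain M where M: "continuous_on UNIV M" "\<And>w. H w = exp (M w)"
    using continuous_logarithm_on_contractible[of UNIV H] contractible_UNIV by auto
  obtain R where "R > 0" "closure \<Omega> \<subseteq> ball 0 R"
    using bounded_closure[OF \<Omega>(2)] bounded_subset_ballD by blast
  then have R: "norm w < R" if "w \<in> closure \<Omega>" for w using that by auto
  have "(\<Sum>z\<in>Z. if s z then 1 else - 1 :: real) = 0"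
  proof (rule prod_simple_factors_exp[OF \<open>finite Z\<close>])
    show "norm z < R" if "z \<in> Z" for z
      using that closure_subset[of \<Omega>] R by (auto simp: Z_def)
    show "continuous_on (sphere 0 R) (\<lambda>w. L' w - M w)"
      by (intro continuous_intros continuous_on_subset[OF L'(1)] continuous_on_subset[OF M(1)]) auto
    \<comment> \<open>The large circle lies outside the closure, where \<open>H\<close> is given by
      its outer branch; hence \<open>?P\<close> is a quotient of two exponentials.\<close>
    fix w :: "real ^ 2" assume "norm w = R"
    then have w: "w \<notin> closure \<Omega>" using R by fastforce
    then have "exp (L' w) / ?P w = exp (M w)" using M(2)[of w] by (simp add: H_def)
    moreover have "?P w \<noteq> 0" using w closure_subset by (intro P0) blast
    ultimately show "?P w = exp (L' w - M w)" by (simp add: exp_diff field_simps)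
  qed
  moreover have "sgn (det (jacobian g (at z))) = (if s z then 1 else - 1)" if "z \<in> Z" for z
    using reg that by (auto simp: Z_def s_def sgn_if)
  ultimately show ?thesis by (simp flip: Z_def)
qed simp

section \<open>Polynomial maps and regular approximations\<close>

text \<open>A gradient with polynomial components matches the recursion of \<open>Ck_fun\<close>, so
  the smoothness of polynomials follows by induction on the order.\<close>

lemma real_polynomial_function_derivative:
  fixes p :: "real ^ 'n \<Rightarrow> real"
  assumes "real_polynomial_function p"
  shows "\<exists>D :: real ^ 'n \<Rightarrow> real ^ 'n. (\<forall>x. (p has_derivative (\<lambda>v. D x \<bullet> v)) (at x)) \<and>
    (\<forall>i. real_polynomial_function (\<lambda>x. D x $ i))"
  using assms
proof induction
  case (linear p)
  let ?D = "\<chi> i. p (axis i 1)"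
  have "p v = ?D \<bullet> v" for v
  proof -
    have "p v = p (\<Sum>i\<in>UNIV. v $ i *\<^sub>R axis i 1)"
      using basis_expansion[of v] by (simp add: scalar_mult_eq_scaleR)
    also have "\<dots> = (\<Sum>i\<in>UNIV. v $ i * p (axis i 1))"
      using linear by (simp add: bounded_linear.linear linear_sum linear_cmul)
    finally show ?thesis by (simp add: inner_vec_def mult.commute)
  qed
  then have "p = (\<lambda>v. ?D \<bullet> v)" by (rule ext)
  from this[symmetric] have "(p has_derivative (\<lambda>v. ?D \<bullet> v)) (at x)" for x
    using bounded_linear_imp_has_derivative[OF linear] by simp
  then show ?case
    by (intro exI[of _ "\<lambda>x. ?D"]) (simp add: real_polynomial_function.intros(2))
next
  case (const c)
  have "((\<lambda>x. c) has_derivative (\<lambda>v. (0 :: real ^ 'n) \<bullet> v)) (at x)" for x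
    by simp
  then show ?case
    by (intro exI[of _ "\<lambda>x. 0"]) (simp add: real_polynomial_function.intros(2))
next
  case (add p q)
  then obtain D E where D: "\<And>x. (p has_derivative (\<lambda>v. D x \<bullet> v)) (at x)" "\<And>i. real_polynomial_function (\<lambda>x. D x $ i)"
    and E: "\<And>x. (q has_derivative (\<lambda>v. E x \<bullet> v)) (at x)" "\<And>i. real_polynomial_function (\<lambda>x. E x $ i)" by blast
  have "((\<lambda>x. p x + q x) has_derivative (\<lambda>v. (D x + E x) \<bullet> v)) (at x)" for x
    using has_derivative_add[OF D(1) E(1)] by (simp add: inner_add_left)
  then show ?case
    using D(2) E(2)
    by (intro exI[of _ "\<lambda>x. D x + E x"]) (simp add: real_polynomial_function.intros(3))
next
  case (mult p q)
  then obtain D E where D: "\<And>x. (p has_derivative (\<lambda>v. D x \<bullet> v)) (at x)" "\<And>i. real_polynomial_function (\<lambda>x. D x $ i)"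
    and E: "\<And>x. (q has_derivative (\<lambda>v. E x \<bullet> v)) (at x)" "\<And>i. real_polynomial_function (\<lambda>x. E x $ i)" by blast
  have "((\<lambda>x. p x * q x) has_derivative (\<lambda>v. (p x *\<^sub>R E x + q x *\<^sub>R D x) \<bullet> v)) (at x)" for x
    using has_derivative_mult[OF D(1) E(1)] by (simp add: inner_add_left mult.commute)
  then show ?case
    using D(2) E(2) mult.hyps
    by (intro exI[of _ "\<lambda>x. p x *\<^sub>R E x + q x *\<^sub>R D x"])
      (simp add: real_polynomial_function.intros(3) real_polynomial_function.intros(4))
qed

lemma Ck_fun_real_polynomial_function:
  "real_polynomial_function p \<Longrightarrow> Ck_fun k p"
proof (induction k arbitrary: p)
  case 0
  then show ?case
    by (simp add: continuous_on_polymonial_function real_polynomial_function_eq)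
next
  case (Suc k)
  obtain D where "\<And>x. (p has_derivative (\<lambda>v. D x \<bullet> v)) (at x)" "\<And>i. real_polynomial_function (\<lambda>x. D x $ i)"
    using real_polynomial_function_derivative[OF Suc.prems] by blast
  then show ?case unfolding Ck_fun.simps by (intro exI[of _ D]) (simp add: Suc.IH)
qed

lemma smooth_map_polynomial_function:
  fixes p :: "real ^ 'n \<Rightarrow> real ^ 'm"
  assumes "polynomial_function p"
  shows "smooth_map p"
proof -
  have "real_polynomial_function (\<lambda>x. p x $ i)" for i
    using assms unfolding polynomial_function_iff_Basis_inner
    by (simp add: cart_eq_inner_axis axis_in_Basis_iff)
  then show ?thesis by (simp add: smooth_map_def Ck_fun_real_polynomial_function)
qed

lemma smooth_map_differentiable:
  fixes g :: "real ^ 'n \<Rightarrow> real ^ 'm"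
  assumes "smooth_map g"
  shows "g differentiable (at x)"
proof -
  have "Ck_fun (Suc 0) (\<lambda>x. g x $ i)" for i
    using assms unfolding smooth_map_def by blast
  then have "(\<lambda>x. g x $ i) differentiable (at x)" for i
    unfolding Ck_fun.simps differentiable_def by blast
  then show ?thesis
    by (subst differentiable_componentwise_within) (auto simp: Basis_vec_def inner_axis)
qed

text \<open>Weierstrass gives a polynomial map \<open>P\<close> within \<open>e / 2\<close> of
  \<open>f\<close>. By Sard its critical values are negligible, so some \<open>q\<close> within
  \<open>e / 2\<close> of \<open>p\<close> is not one of them, and translating \<open>P\<close> by
  \<open>p - q\<close> makes \<open>p\<close> a regular value.\<close>

lemma regular_approx_exists:
  fixes f :: "real ^ 'n::{finite, wellorder} \<Rightarrow> real ^ 'n::{finite, wellorder}"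
  assumes \<Omega>: "open \<Omega>" "bounded \<Omega>" "\<Omega> \<noteq> {}" and f: "continuous_on (closure \<Omega>) f"
    and p: "p \<notin> f ` frontier \<Omega>"
  shows "\<exists>g. regular_approx f \<Omega> p g"
proof -
  have cpt: "compact (closure \<Omega>)" "compact (frontier \<Omega>)"
    using \<Omega> by (auto simp: compact_frontier_bounded)
  \<comment> \<open>This excludes the convention that the distance to the empty set is 0, under
    which no map would be close enough.\<close>
  have "frontier \<Omega> \<noteq> {}"
    using \<Omega> frontier_eq_empty not_bounded_UNIV by blast
  define e where "e = infdist p (f ` frontier \<Omega>)"
  have "closed (f ` frontier \<Omega>)"
    using cpt f by (intro compact_imp_closed compact_continuous_image)
      (auto intro: continuous_on_subset simp: frontier_def)
  then have "e > 0"
    unfolding e_def using p \<open>frontier \<Omega> \<noteq> {}\<close> by (intro infdist_pos_not_in_closed) auto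
  then obtain P where P: "polynomial_function P" "\<And>x. x \<in> closure \<Omega> \<Longrightarrow> norm (f x - P x) < e / 2"
    using Stone_Weierstrass_polynomial_function[OF cpt(1) f, of "e / 2"] by auto
  have dP: "(P has_derivative (\<lambda>h. jacobian P (at x) *v h)) (at x)" for x
    using smooth_map_differentiable[OF smooth_map_polynomial_function[OF P(1)]] jacobian_works by blast
  have "negligible (P ` {x. det (jacobian P (at x)) = 0})"
  proof (rule baby_Sard)
    show "(P has_derivative (\<lambda>h. jacobian P (at x) *v h)) (at x within {x. det (jacobian P (at x)) = 0})" for x
      using dP has_derivative_at_withinI by blast
  qed (auto simp: det_eq_0_rank)
  then have "\<not> ball p (e / 2) \<subseteq> P ` {x. det (jacobian P (at x)) = 0}"
    using \<open>e > 0\<close> negligible_subset open_not_negligible[of "ball p (e / 2)"] by auto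
  then obtain q where "q \<in> ball p (e / 2)" and q: "q \<notin> P ` {x. det (jacobian P (at x)) = 0}" by blast
  then have pq: "norm (p - q) < e / 2" by (simp add: dist_norm)
  let ?g = "\<lambda>x. P x + (p - q)"
  have jac: "jacobian ?g (at x) = jacobian P (at x)" for x
  proof -
    have "(?g has_derivative (\<lambda>h. jacobian P (at x) *v h)) (at x)"
      using dP by (auto intro!: derivative_eq_intros)
    then show ?thesis
      unfolding jacobian_def by (metis frechet_derivative_at matrix_of_matrix_vector_mul dP)
  qed
  have "regular_approx f \<Omega> p ?g"
    unfolding regular_approx_def
  proof (intro conjI ballI impI)
    show "smooth_map ?g"
      using P(1) by (intro smooth_map_polynomial_function polynomial_function_add) auto
    show "dist (?g x) (f x) < infdist p (f ` frontier \<Omega>)" if "x \<in> closure \<Omega>" for x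
    proof -
      have "dist (?g x) (f x) = norm ((P x - f x) + (p - q))"
        by (simp add: dist_norm algebra_simps)
      also have "\<dots> < e / 2 + e / 2"
        using P(2)[OF that] pq norm_triangle_ineq[of "P x - f x" "p - q"]
        by (simp add: norm_minus_commute)
      finally show ?thesis by (simp add: e_def)
    qed
    show "det (jacobian ?g (at x)) \<noteq> 0" if "x \<in> \<Omega>" "?g x = p" for x
      using q that(2) unfolding jac by auto
  qed
  then show ?thesis by blast
qed

text \<open>On the boundary a regular approximation \<open>g\<close> differs from \<open>f\<close>
  by less than \<open>norm (f x)\<close>, so \<open>g / f\<close> has positive real part in complex
  notation. Adding its principal logarithm to \<open>L\<close> gives a logarithm of
  \<open>g\<close>, hence every regular approximation has signed count 0.\<close>

lemma brouwer_degree_eq_0: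
  fixes f :: "real ^ 2 \<Rightarrow> real ^ 2"
  assumes \<Omega>: "open \<Omega>" "bounded \<Omega>" "\<Omega> \<noteq> {}" and f: "continuous_on (closure \<Omega>) f"
    and L: "continuous_on (frontier \<Omega>) L" "\<And>x. x \<in> frontier \<Omega> \<Longrightarrow> cplx (f x) = exp (L x)"
  shows "brouwer_degree f \<Omega> 0 = 0"
proof -
  have f0: "f x \<noteq> 0" if "x \<in> frontier \<Omega>" for x
    using L(2)[OF that] by (metis cplx_0 exp_not_eq_zero)
  then have notin: "0 \<notin> f ` frontier \<Omega>" by (metis imageE)
  have count: "(\<Sum>x\<in>{x \<in> \<Omega>. g x = 0}. sgn (det (jacobian g (at x)))) = 0"
    if g: "regular_approx f \<Omega> 0 g" for g
  proof -
    have diff: "g differentiable (at x)" for x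
      using g smooth_map_differentiable unfolding regular_approx_def by blast
    then have cont: "continuous_on S g" for S
      by (simp add: continuous_at_imp_continuous_on differentiable_imp_continuous_within)
    have close: "norm (cplx (g x) / cplx (f x) - 1) < 1" if "x \<in> frontier \<Omega>" for x
    proof -
      have "dist (g x) (f x) < infdist 0 (f ` frontier \<Omega>)"
        using g that unfolding regular_approx_def by (simp add: frontier_def)
      also have "\<dots> \<le> norm (f x)"
        using infdist_le[of "f x" "f ` frontier \<Omega>" 0] that by simp
      finally have "norm (cplx (g x) - cplx (f x)) < norm (cplx (f x))"
        by (simp add: dist_norm flip: cplx_diff)
      moreover have "cplx (g x) / cplx (f x) - 1 = (cplx (g x) - cplx (f x)) / cplx (f x)"
        using f0[OF that] by (simp add: field_simps)
      ultimately show ?thesis using f0[OF that] by (simp add: norm_divide)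
    qed
    have pos: "Re (cplx (g x) / cplx (f x)) > 0" if "x \<in> frontier \<Omega>" for x
      using close[OF that] abs_Re_le_cmod[of "cplx (g x) / cplx (f x) - 1"] by (simp add: abs_if split: if_splits)
    show ?thesis
    proof (rule signed_zero_count_eq_0[OF \<Omega>(1,2) cont])
      show "continuous_on (frontier \<Omega>) (\<lambda>x. L x + Ln (cplx (g x) / cplx (f x)))"
        using pos f0
        by (intro continuous_intros L cont continuous_on_subset[OF f])
          (auto simp: complex_nonpos_Reals_iff frontier_def not_le[symmetric])
      show "cplx (g x) = exp (L x + Ln (cplx (g x) / cplx (f x)))" if "x \<in> frontier \<Omega>" for x
      proof -
        have "cplx (g x) / cplx (f x) \<noteq> 0" using pos[OF that] by (metis less_irrefl zero_complex.simps(1))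
        then have "exp (L x + Ln (cplx (g x) / cplx (f x))) = cplx (f x) * (cplx (g x) / cplx (f x))"
          by (simp add: exp_add L(2)[OF that])
        then show ?thesis using f0[OF that] by simp
      qed
    qed (use diff g in \<open>auto simp: regular_approx_def\<close>)
  qed
  \<comment> \<open>Existence makes the number picked by \<open>THE\<close> unique; otherwise every
    integer would satisfy its condition vacuously.\<close>
  obtain g where g: "regular_approx f \<Omega> 0 g"
    using regular_approx_exists[OF \<Omega> f notin] by blast
  have "(THE d. \<forall>g. regular_approx f \<Omega> 0 g \<longrightarrow>
      real_of_int d = (\<Sum>x\<in>{x \<in> \<Omega>. g x = 0}. sgn (det (jacobian g (at x))))) = 0"
    using g count by (intro the_equality) auto
  then show ?thesis by (simp add: brouwer_degree_def)
qed

section \<open>A shooting argument without uniqueness\<close>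

text \<open>Freezing the integrand at \<open>min s t\<close> moves the variable limit into the
  integrand, so that continuity of integrals over a fixed interval applies. The excess over
  \<open>[t, T]\<close> is \<open>(T - t) * F x t\<close> and is subtracted.\<close>

lemma continuous_on_parametric_primitive:
  fixes F :: "'a::topological_space \<Rightarrow> real \<Rightarrow> real"
  assumes F: "continuous_on (S \<times> {0..T}) (\<lambda>(x, s). F x s)"
  shows "continuous_on (S \<times> {0..T}) (\<lambda>(x, t). integral {0..t} (F x))"
proof -
  have cont_x: "continuous_on {0..T} (F x)" if "x \<in> S" for x
  proof -
    have "continuous_on {0..T} (\<lambda>s. (x, s))" by (intro continuous_intros)
    from continuous_on_compose2[OF F this] show ?thesis using that by auto
  qed
  have "continuous_on ((S \<times> {0..T}) \<times> cbox 0 T) (\<lambda>y. (fst (fst y), min (snd y) (snd (fst y))))"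
    by (intro continuous_intros)
  from continuous_on_compose2[OF F this]
  have "continuous_on ((S \<times> {0..T}) \<times> cbox 0 T) (\<lambda>(z, s). F (fst z) (min s (snd z)))"
    by (auto simp: split_beta image_subset_iff min_le_iff_disj)
  then have "continuous_on (S \<times> {0..T}) (\<lambda>z. integral (cbox 0 T) (\<lambda>s. F (fst z) (min s (snd z))))"
    by (rule integral_continuous_on_param)
  then have "continuous_on (S \<times> {0..T})
      (\<lambda>z. integral (cbox 0 T) (\<lambda>s. F (fst z) (min s (snd z))) - (T - snd z) * (\<lambda>(x, s). F x s) z)"
    by (intro continuous_intros F)
  then show ?thesis
  proof (rule continuous_on_eq)
    fix z assume z: "z \<in> S \<times> {0..T}"
    obtain x t where xt: "z = (x, t)" by fastforce
    then have that: "x \<in> S" "t \<in> {0..T}" using z by auto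
    have "continuous_on {0..T} (\<lambda>s. F x (min s t))"
      by (rule continuous_on_compose2[OF cont_x[OF that(1)]])
        (use that in \<open>auto intro!: continuous_intros simp: min_le_iff_disj\<close>)
    then have "integral {0..T} (\<lambda>s. F x (min s t)) =
        integral {0..t} (\<lambda>s. F x (min s t)) + integral {t..T} (\<lambda>s. F x (min s t))"
      using that by (intro Henstock_Kurzweil_Integration.integral_combine[symmetric] integrable_continuous_real) auto
    also have "integral {0..t} (\<lambda>s. F x (min s t)) = integral {0..t} (F x)"
      by (intro integral_cong) auto
    also have "integral {t..T} (\<lambda>s. F x (min s t)) = integral {t..T} (\<lambda>s. F x t)"
      by (intro integral_cong) (auto simp: min_def)
    finally show "integral (cbox 0 T) (\<lambda>s. F (fst z) (min s (snd z))) - (T - snd z) * (\<lambda>(x, s). F x s) z =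
        (\<lambda>(x, t). integral {0..t} (F x)) z"
      using that by (simp add: xt)
  qed
qed

lemma zero_of_sign_change:
  fixes g :: "real \<Rightarrow> real"
  assumes "continuous_on {a..b} g" "a \<le> b" "g a * g b \<le> 0"
  shows "\<exists>x\<in>{a..b}. g x = 0"
proof -
  consider "g a \<le> 0" "0 \<le> g b" | "0 \<le> g a" "g b \<le> 0"
    using assms(3) by (auto simp: mult_le_0_iff)
  then show ?thesis
  proof cases
    case 1
    then show ?thesis using IVT'[of g a 0 b] assms by auto
  next
    case 2
    then show ?thesis using IVT2'[of g b 0 a] assms by auto
  qed
qed

text \<open>With a delay \<open>\<delta>\<close> the Picard iteration becomes stationary after finitely many steps (its
  \<open>k\<close>-th iterate is final on \<open>[0, k \<delta>]\<close>), so continuous dependence on the initial value is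
  immediate although the undelayed problem may have many solutions.\<close>

definition delay :: "real \<Rightarrow> real \<Rightarrow> real" where
  "delay \<delta> s = max 0 (s - \<delta>)"

definition primitive_from :: "real \<Rightarrow> (real \<Rightarrow> real) \<Rightarrow> real \<Rightarrow> real" where
  "primitive_from x w t = x + integral {0..t} w"

text \<open>The iterates approximate \<open>v = \<phi> (u')\<close>, with \<open>\<psi>\<close> in
  the role of the inverse of \<open>\<phi>\<close>. The parameter \<open>x\<close> serves both as
  \<open>u(0)\<close> and as \<open>u'(0)\<close>, which builds in the first boundary
  condition.\<close>

primrec delayed_picard ::
  "(real \<Rightarrow> real) \<Rightarrow> (real \<Rightarrow> real) \<Rightarrow> (real \<Rightarrow> real \<Rightarrow> real \<Rightarrow> real) \<Rightarrow> real \<Rightarrow> nat \<Rightarrow> real \<Rightarrow> real \<Rightarrow> real" where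
  "delayed_picard \<phi> \<psi> f \<delta> 0 x t = \<phi> x"
| "delayed_picard \<phi> \<psi> f \<delta> (Suc k) x t = \<phi> x + integral {0..t} (\<lambda>s.
     f s (primitive_from x (\<lambda>r. \<psi> (delayed_picard \<phi> \<psi> f \<delta> k x r)) (delay \<delta> s))
         (\<psi> (delayed_picard \<phi> \<psi> f \<delta> k x (delay \<delta> s))))"

lemma continuous_on_primitive_from:
  assumes V: "continuous_on (UNIV \<times> {0..T}) (\<lambda>(x, t). V x t)" and \<psi>: "continuous_on UNIV \<psi>"
  shows "continuous_on (UNIV \<times> {0..T}) (\<lambda>(x, t). primitive_from x (\<lambda>r. \<psi> (V x r)) t)"
proof -
  have "continuous_on (UNIV \<times> {0..T}) (\<lambda>(x, t). \<psi> (V x t))"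
    using continuous_on_compose2[OF \<psi> V] by (simp add: split_beta)
  from continuous_on_parametric_primitive[OF this] show ?thesis
    unfolding primitive_from_def split_beta by (intro continuous_intros)
qed

lemma continuous_on_superposition:
  fixes f :: "real \<Rightarrow> real \<Rightarrow> real \<Rightarrow> real"
  assumes f: "continuous_on ({0..T} \<times> UNIV \<times> UNIV) (\<lambda>(t, x, y). f t x y)"
    and "continuous_on S a" "continuous_on S b" "continuous_on S c" "\<And>z. z \<in> S \<Longrightarrow> a z \<in> {0..T}"
  shows "continuous_on S (\<lambda>z. f (a z) (b z) (c z))"
  using continuous_on_compose2[OF f continuous_on_Pair[OF assms(2) continuous_on_Pair[OF assms(3,4)]]] assms(5)
  by (simp add: image_subset_iff)

lemma continuous_on_delayed_picard:
  assumes f: "continuous_on ({0..T} \<times> UNIV \<times> UNIV) (\<lambda>(t, x, y). f t x y)"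
    and \<phi>: "continuous_on UNIV \<phi>" and \<psi>: "continuous_on UNIV \<psi>" and "0 \<le> \<delta>"
  shows "continuous_on (UNIV \<times> {0..T}) (\<lambda>(x, t). delayed_picard \<phi> \<psi> f \<delta> k x t)"
proof (induction k)
  case 0
  show ?case using continuous_on_compose2[OF \<phi> continuous_on_fst[OF continuous_on_id]]
    by (simp add: split_beta)
next
  case (Suc k)
  let ?V = "delayed_picard \<phi> \<psi> f \<delta> k"
  let ?d = "\<lambda>z :: real \<times> real. (fst z, delay \<delta> (snd z))"
  have d: "continuous_on (UNIV \<times> {0..T}) ?d" "?d ` (UNIV \<times> {0..T}) \<subseteq> UNIV \<times> {0..T}"
    using \<open>0 \<le> \<delta>\<close> by (auto simp: delay_def intro!: continuous_intros)
  have "continuous_on (UNIV \<times> {0..T}) (\<lambda>z. ?V (fst z) (delay \<delta> (snd z)))"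
    using continuous_on_compose2[OF Suc d] by simp
  then have 1: "continuous_on (UNIV \<times> {0..T}) (\<lambda>z. \<psi> (?V (fst z) (delay \<delta> (snd z))))"
    by (rule continuous_on_compose2[OF \<psi>]) simp
  have 2: "continuous_on (UNIV \<times> {0..T}) (\<lambda>z. primitive_from (fst z) (\<lambda>r. \<psi> (?V (fst z) r)) (delay \<delta> (snd z)))"
    using continuous_on_compose2[OF continuous_on_primitive_from[OF Suc \<psi>] d] by simp
  have "continuous_on (UNIV \<times> {0..T}) (\<lambda>(x, s).
      f s (primitive_from x (\<lambda>r. \<psi> (?V x r)) (delay \<delta> s)) (\<psi> (?V x (delay \<delta> s))))"
    unfolding split_beta using 1 2
    by (intro continuous_on_superposition[OF f]) (auto intro!: continuous_intros)
  from continuous_on_parametric_primitive[OF this] show ?case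
    unfolding delayed_picard.simps split_beta
    by (intro continuous_intros continuous_on_compose2[OF \<phi>]) auto
qed

text \<open>At time \<open>s\<close> the integrand reads the preceding iterate only up to time
  \<open>s - \<delta>\<close>, or at 0 where the delay is cut off. One more iteration therefore
  extends the interval of agreement by \<open>\<delta>\<close>.\<close>

lemma delayed_picard_stationary:
  assumes "0 < \<delta>" "0 \<le> t" "t \<le> real k * \<delta>"
  shows "delayed_picard \<phi> \<psi> f \<delta> (Suc k) x t = delayed_picard \<phi> \<psi> f \<delta> k x t"
  using assms(2,3)
proof (induction k arbitrary: t)
  case 0
  then show ?case by simp
next
  case (Suc k)
  have "delayed_picard \<phi> \<psi> f \<delta> (Suc k) x r = delayed_picard \<phi> \<psi> f \<delta> k x r"
    if "s \<in> {0..t}" "r \<in> {0..delay \<delta> s}" for s r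
  proof (rule Suc.IH)
    have "s - \<delta> \<le> real k * \<delta>" using that(1) Suc.prems by (simp add: algebra_simps)
    moreover have "0 \<le> real k * \<delta>" using \<open>0 < \<delta>\<close> by simp
    ultimately show "0 \<le> r" "r \<le> real k * \<delta>"
      using that(2) by (auto simp: delay_def)
  qed
  note eq = this
  have "integral {0..t} (\<lambda>s.
     f s (primitive_from x (\<lambda>r. \<psi> (delayed_picard \<phi> \<psi> f \<delta> (Suc k) x r)) (delay \<delta> s))
         (\<psi> (delayed_picard \<phi> \<psi> f \<delta> (Suc k) x (delay \<delta> s)))) = integral {0..t} (\<lambda>s.
     f s (primitive_from x (\<lambda>r. \<psi> (delayed_picard \<phi> \<psi> f \<delta> k x r)) (delay \<delta> s))
         (\<psi> (delayed_picard \<phi> \<psi> f \<delta> k x (delay \<delta> s))))"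
  proof (rule integral_cong)
    fix s assume s: "s \<in> {0..t}"
    have "integral {0..delay \<delta> s} (\<lambda>r. \<psi> (delayed_picard \<phi> \<psi> f \<delta> (Suc k) x r)) =
        integral {0..delay \<delta> s} (\<lambda>r. \<psi> (delayed_picard \<phi> \<psi> f \<delta> k x r))"
      by (rule integral_cong) (simp only: eq[OF s])
    moreover have "delayed_picard \<phi> \<psi> f \<delta> (Suc k) x (delay \<delta> s) = delayed_picard \<phi> \<psi> f \<delta> k x (delay \<delta> s)"
      by (rule eq[OF s]) (simp add: delay_def)
    ultimately show "f s (primitive_from x (\<lambda>r. \<psi> (delayed_picard \<phi> \<psi> f \<delta> (Suc k) x r)) (delay \<delta> s))
         (\<psi> (delayed_picard \<phi> \<psi> f \<delta> (Suc k) x (delay \<delta> s))) =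
     f s (primitive_from x (\<lambda>r. \<psi> (delayed_picard \<phi> \<psi> f \<delta> k x r)) (delay \<delta> s))
         (\<psi> (delayed_picard \<phi> \<psi> f \<delta> k x (delay \<delta> s)))"
      unfolding primitive_from_def by presburger
  qed
  then show ?case unfolding delayed_picard.simps(2)[of _ _ _ _ "Suc k"] delayed_picard.simps(2)[of _ _ _ _ k]
    by presburger
qed

lemma delayed_solution_exists:
  fixes \<phi> \<psi> :: "real \<Rightarrow> real"
  assumes "0 < T" "0 < \<delta>"
    and f: "continuous_on ({0..T} \<times> UNIV \<times> UNIV) (\<lambda>(t, x, y). f t x y)"
    and \<phi>: "continuous_on UNIV \<phi>" and \<psi>: "continuous_on UNIV \<psi>"
  obtains V where "continuous_on (UNIV \<times> {0..T}) (\<lambda>(x, t). V x t)"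
    and "\<And>x t. t \<in> {0..T} \<Longrightarrow> V x t = \<phi> x + integral {0..t}
      (\<lambda>s. f s (primitive_from x (\<lambda>r. \<psi> (V x r)) (delay \<delta> s)) (\<psi> (V x (delay \<delta> s))))"
proof -
  \<comment> \<open>Enough steps of length \<open>\<delta>\<close> to cover \<open>[0, T]\<close>,
    so the iterate is a fixed point there for all \<open>x\<close> at once.\<close>
  obtain k where "T / \<delta> \<le> real k" using real_arch_simple by blast
  then have k: "T \<le> real k * \<delta>" using \<open>0 < \<delta>\<close> by (simp add: field_simps)
  show thesis
  proof (rule that[of "delayed_picard \<phi> \<psi> f \<delta> k"])
    show "continuous_on (UNIV \<times> {0..T}) (\<lambda>(x, t). delayed_picard \<phi> \<psi> f \<delta> k x t)"
      using continuous_on_delayed_picard[OF f \<phi> \<psi>] \<open>0 < \<delta>\<close> by simp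
    fix x t assume "t \<in> {0..T}"
    then show "delayed_picard \<phi> \<psi> f \<delta> k x t = \<phi> x + integral {0..t}
      (\<lambda>s. f s (primitive_from x (\<lambda>r. \<psi> (delayed_picard \<phi> \<psi> f \<delta> k x r)) (delay \<delta> s))
        (\<psi> (delayed_picard \<phi> \<psi> f \<delta> k x (delay \<delta> s))))"
      using delayed_picard_stationary[OF \<open>0 < \<delta>\<close>, of t k \<phi> \<psi> f x] k by auto
  qed
qed

text \<open>\<open>E x v\<close> is the shooting functional: the derivative at \<open>0\<close> is \<open>x = \<psi> (v 0)\<close>, and \<open>v\<close> plays
  the role of \<open>\<phi> (u')\<close>.\<close>

lemma shooting:
  fixes f :: "real \<Rightarrow> real \<Rightarrow> real \<Rightarrow> real" and \<phi> \<psi> B :: "real \<Rightarrow> real"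
  assumes T: "0 < T"
    and f: "continuous_on ({0..T} \<times> UNIV \<times> UNIV) (\<lambda>(t, x, y). f t x y)"
    and H: "\<And>t x y. t \<in> {0..T} \<Longrightarrow> \<bar>f t x y\<bar> \<le> H"
    and \<phi>: "continuous_on UNIV \<phi>" and \<psi>: "continuous_on UNIV \<psi>"
    and \<psi>\<phi>: "\<And>x. \<psi> (\<phi> x) = x" and B: "continuous_on UNIV B"
  defines "E \<equiv> \<lambda>x v. integral {0..T} (\<lambda>t. f t (primitive_from x (\<lambda>r. \<psi> (v r)) t) (\<psi> (v t))) - B x"
  assumes ab: "a \<le> b"
    and sign: "\<And>v v'. continuous_on {0..T} v \<Longrightarrow> continuous_on {0..T} v' \<Longrightarrow> v 0 = \<phi> a \<Longrightarrow> v' 0 = \<phi> b \<Longrightarrow>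
      (\<And>t. t \<in> {0..T} \<Longrightarrow> \<bar>v t - \<phi> a\<bar> \<le> H * T) \<Longrightarrow> (\<And>t. t \<in> {0..T} \<Longrightarrow> \<bar>v' t - \<phi> b\<bar> \<le> H * T) \<Longrightarrow>
      E a v * E b v' \<le> 0"
  obtains x v where "continuous_on {0..T} v" "E x v = 0"
    and "\<forall>t\<in>{0..T}.
      v t = \<phi> x + integral {0..t} (\<lambda>s. f s (primitive_from x (\<lambda>r. \<psi> (v r)) s) (\<psi> (v s)))"
proof -
  have "0 \<le> H" using H[of 0 0 0] T by auto
  define \<delta> where "\<delta> n = inverse (real (Suc n))" for n
  have \<delta>: "\<delta> n > 0" for n by (simp add: \<delta>_def)
  have \<delta>0: "\<delta> \<longlonglongrightarrow> 0" unfolding \<delta>_def by (rule LIMSEQ_inverse_real_of_nat)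
  have delay_in: "delay (\<delta> n) s \<in> {0..T}" if "s \<in> {0..T}" for n s
    using that \<delta>[of n] by (auto simp: delay_def)
  have "\<forall>n. \<exists>V. continuous_on (UNIV \<times> {0..T}) (\<lambda>(x, t). V x t) \<and> (\<forall>x. \<forall>t\<in>{0..T}. V x t = \<phi> x + integral {0..t}
      (\<lambda>s. f s (primitive_from x (\<lambda>r. \<psi> (V x r)) (delay (\<delta> n) s)) (\<psi> (V x (delay (\<delta> n) s)))))"
    by (rule allI, rule delayed_solution_exists[OF T \<delta> f \<phi> \<psi>]) blast
  from choice[OF this] obtain V where V_all:
    "\<forall>n. continuous_on (UNIV \<times> {0..T}) (\<lambda>(x, t). V n x t) \<and> (\<forall>x. \<forall>t\<in>{0..T}. V n x t = \<phi> x + integral {0..t}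
      (\<lambda>s. f s (primitive_from x (\<lambda>r. \<psi> (V n x r)) (delay (\<delta> n) s)) (\<psi> (V n x (delay (\<delta> n) s)))))" ..
  have V: "continuous_on (UNIV \<times> {0..T}) (\<lambda>(x, t). V n x t)" for n
    using V_all by blast
  have V_eq: "V n x t = \<phi> x + integral {0..t}
      (\<lambda>s. f s (primitive_from x (\<lambda>r. \<psi> (V n x r)) (delay (\<delta> n) s)) (\<psi> (V n x (delay (\<delta> n) s))))"
    if "t \<in> {0..T}" for n x t
    using V_all that by blast
  define g where "g n x s = f s (primitive_from x (\<lambda>r. \<psi> (V n x r)) (delay (\<delta> n) s)) (\<psi> (V n x (delay (\<delta> n) s)))" for n x s
  have V_g: "V n x t = \<phi> x + integral {0..t} (g n x)" if "t \<in> {0..T}" for n x t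
    using V_eq[OF that] unfolding g_def .
  have contV: "continuous_on {0..T} (V n x)" for n x
  proof -
    have "continuous_on {0..T} (\<lambda>s. (x, s))" by (intro continuous_intros)
    from continuous_on_compose2[OF V[of n] this] show ?thesis by auto
  qed
  have contw: "continuous_on {0..T} (\<lambda>t. \<psi> (V n x t))" for n x
    by (rule continuous_on_compose2[OF \<psi> contV]) simp
  have contu: "continuous_on {0..T} (primitive_from x (\<lambda>r. \<psi> (V n x r)))" for n x
    unfolding primitive_from_def
    by (intro continuous_intros indefinite_integral_continuous_1 integrable_continuous_real contw)
  have cont_delay: "continuous_on {0..T} (delay (\<delta> n))" for n
    unfolding delay_def by (intro continuous_intros)
  have contg: "continuous_on {0..T} (g n x)" for n x
    unfolding g_def
    by (intro continuous_on_superposition[OF f] continuous_on_compose2[OF contu cont_delay]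
        continuous_on_compose2[OF contw cont_delay] continuous_on_id) (use delay_in in auto)
  have g_bd: "\<bar>g n x s\<bar> \<le> H" if "s \<in> {0..T}" for n x s
    unfolding g_def using H[OF that] .
  have lip: "\<bar>integral {0..t} q - integral {0..s} q\<bar> \<le> K * \<bar>t - s\<bar>"
    if q: "continuous_on {0..T} q" and K: "\<And>r. r \<in> {0..T} \<Longrightarrow> \<bar>q r\<bar> \<le> K" and st: "s \<in> {0..T}" "t \<in> {0..T}"
    for q :: "real \<Rightarrow> real" and K s t
  proof -
    have main: "\<bar>integral {0..t} q - integral {0..s} q\<bar> \<le> K * \<bar>t - s\<bar>" if "s \<le> t" "s \<in> {0..T}" "t \<in> {0..T}" for s t
    proof -
      have "integral {0..s} q + integral {s..t} q = integral {0..t} q"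
        using that by (intro Henstock_Kurzweil_Integration.integral_combine integrable_continuous_real continuous_on_subset[OF q]) auto
      moreover have "norm (integral {s..t} q) \<le> K * (t - s)"
        using that by (intro integral_bound continuous_on_subset[OF q]) (auto intro: K)
      ultimately show ?thesis using that by auto
    qed
    show ?thesis using main[of s t] main[of t s] st by (cases "s \<le> t") (auto simp: abs_minus_commute)
  qed
  have V_lip: "\<bar>V n x t - V n x s\<bar> \<le> H * \<bar>t - s\<bar>" if "s \<in> {0..T}" "t \<in> {0..T}" for n x s t
    using lip[OF contg[of n x] g_bd that] V_g[of s n x] V_g[of t n x] that by simp
  have V0: "V n x 0 = \<phi> x" for n x using V_g[of 0 n x] T by simp
  have V_bd: "\<bar>V n x t - \<phi> x\<bar> \<le> H * T" if "t \<in> {0..T}" for n x t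
  proof -
    have "\<bar>V n x t - V n x 0\<bar> \<le> H * \<bar>t - 0\<bar>" using that T by (intro V_lip) auto
    also have "\<dots> \<le> H * T" using that \<open>0 \<le> H\<close> by (intro mult_left_mono) auto
    finally show ?thesis by (simp add: V0)
  qed
  \<comment> \<open>\<open>E\<close> itself contains no delay. The sign hypothesis asks only for
    continuity, the initial value and the bound, all of which the delayed solutions satisfy.\<close>
  have "\<exists>x. a \<le> x \<and> x \<le> b \<and> E x (V n x) = 0" for n
  proof -
    have "continuous_on (UNIV \<times> {0..T}) (\<lambda>z. V n (fst z) (snd z))"
      using V[of n] by (simp add: split_beta)
    then have "continuous_on (UNIV \<times> {0..T}) (\<lambda>z. \<psi> (V n (fst z) (snd z)))"
      by (rule continuous_on_compose2[OF \<psi>]) simp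
    then have "continuous_on (UNIV \<times> cbox 0 T) (\<lambda>(x, t). f t (primitive_from x (\<lambda>r. \<psi> (V n x r)) t) (\<psi> (V n x t)))"
      unfolding split_beta using continuous_on_primitive_from[OF V[of n] \<psi>]
      by (intro continuous_on_superposition[OF f]) (auto simp: split_beta intro!: continuous_intros)
    then have "continuous_on UNIV (\<lambda>x. integral (cbox 0 T) (\<lambda>t. f t (primitive_from x (\<lambda>r. \<psi> (V n x r)) t) (\<psi> (V n x t))))"
      by (rule integral_continuous_on_param)
    then have cont: "continuous_on UNIV (\<lambda>x. E x (V n x))"
      unfolding E_def by (intro continuous_intros B) simp
    have "E a (V n a) * E b (V n b) \<le> 0"
      by (intro sign contV V0 V_bd)
    then show ?thesis
      using zero_of_sign_change[OF continuous_on_subset[OF cont subset_UNIV] ab] by auto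
  qed
  then obtain x where x: "\<And>n. x n \<in> {a..b}" "\<And>n. E (x n) (V n (x n)) = 0"
    by (metis atLeastAtMost_iff)
  define v where "v n t = V n (x n) t" for n t
  \<comment> \<open>Since every \<open>x n\<close> lies in the compact interval from
    \<open>a\<close> to \<open>b\<close>, the bounds \<open>M\<close> and \<open>W\<close> derived
    below are uniform in \<open>n\<close>.\<close>
  obtain C where C: "\<And>y. y \<in> {a..b} \<Longrightarrow> \<bar>\<phi> y\<bar> \<le> C"
    using compact_imp_bounded[OF compact_continuous_image[OF continuous_on_subset[OF \<phi> subset_UNIV] compact_Icc[of a b]]]
    unfolding bounded_iff by (metis imageI real_norm_def)
  define M where "M = C + H * T"
  have v_bd: "\<bar>v n t\<bar> \<le> M" if "t \<in> {0..T}" for n t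
    using V_bd[OF that, of n "x n"] C[OF x(1)[of n]] by (simp add: v_def M_def)
  obtain W where W: "\<And>y. y \<in> {-M..M} \<Longrightarrow> \<bar>\<psi> y\<bar> \<le> W"
    using compact_imp_bounded[OF compact_continuous_image[OF continuous_on_subset[OF \<psi> subset_UNIV] compact_Icc[of "-M" M]]]
    unfolding bounded_iff by (metis imageI real_norm_def)
  have w_bd: "\<bar>\<psi> (v n t)\<bar> \<le> W" if "t \<in> {0..T}" for n t
    using v_bd[OF that, of n] by (intro W) auto
  have "0 \<le> W" using w_bd[of 0 0] T by auto
  have equi: "\<exists>d. 0 < d \<and> (\<forall>n s. s \<in> {0..T} \<and> norm (t - s) < d \<longrightarrow> norm (v n t - v n s) < e)"
    if t: "t \<in> {0..T}" and "0 < e" for t e :: real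
  proof (intro exI conjI allI impI)
    \<comment> \<open>\<open>H + 1\<close> replaces the Lipschitz constant \<open>H\<close>, which
      may be 0.\<close>
    show "0 < e / (H + 1)" using \<open>0 < e\<close> \<open>0 \<le> H\<close> by simp
    fix n s assume s: "s \<in> {0..T} \<and> norm (t - s) < e / (H + 1)"
    have "\<bar>v n t - v n s\<bar> \<le> H * \<bar>t - s\<bar>" unfolding v_def using s t by (intro V_lip) auto
    also have "\<dots> \<le> (H + 1) * \<bar>t - s\<bar>" by (intro mult_right_mono) auto
    also have "\<dots> < e" using s \<open>0 \<le> H\<close> by (simp add: field_simps)
    finally show "norm (v n t - v n s) < e" by simp
  qed
  have v_bd': "norm (v n t) \<le> M" if "t \<in> {0..T}" for n t
    using v_bd[OF that] by simp
  obtain v' k where v': "continuous_on {0..T} v'" and k: "strict_mono (k :: nat \<Rightarrow> nat)"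
    and unif: "\<And>e. 0 < e \<Longrightarrow> \<exists>N. \<forall>n t. n \<ge> N \<and> t \<in> {0..T} \<longrightarrow> norm (v (k n) t - v' t) < e"
    using Arzela_Ascoli[of "{0..T}" v M, OF compact_Icc v_bd' equi] by metis
  have lim_v: "(\<lambda>n. v (k n) t) \<longlonglongrightarrow> v' t" if "t \<in> {0..T}" for t
    unfolding LIMSEQ_iff using unif that by meson
  have \<psi>_lim: "(\<lambda>n. \<psi> (p n)) \<longlonglongrightarrow> \<psi> q" if "p \<longlonglongrightarrow> q" for p q
    using \<psi> that by (rule continuous_on_tendsto_compose) auto
  \<comment> \<open>The limit slope is read off from the limit function, because
    \<open>\<psi> (v n 0) = x n\<close>.\<close>
  define x' where "x' = \<psi> (v' 0)"
  have lim_x: "(\<lambda>n. x (k n)) \<longlonglongrightarrow> x'"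
    using \<psi>_lim[OF lim_v[of 0]] T by (simp add: v_def V0 \<psi>\<phi> x'_def)
  have lim_w: "(\<lambda>n. \<psi> (v (k n) t)) \<longlonglongrightarrow> \<psi> (v' t)" if "t \<in> {0..T}" for t
    by (rule \<psi>_lim[OF lim_v[OF that]])
  define u where "u n = primitive_from (x n) (\<lambda>r. \<psi> (v n r))" for n
  define u' where "u' = primitive_from x' (\<lambda>r. \<psi> (v' r))"
  have contwv: "continuous_on {0..T} (\<lambda>r. \<psi> (v n r))" for n unfolding v_def by (rule contw)
  have lim_u: "(\<lambda>n. u (k n) t) \<longlonglongrightarrow> u' t" if t: "t \<in> {0..T}" for t
  proof -
    have "(\<lambda>n. integral {0..t} (\<lambda>r. \<psi> (v (k n) r))) \<longlonglongrightarrow> integral {0..t} (\<lambda>r. \<psi> (v' r))"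
    proof (rule dominated_convergence(2)[where h = "\<lambda>r. W"])
      show "(\<lambda>r. \<psi> (v (k n) r)) integrable_on {0..t}" for n
        using t by (intro integrable_continuous_real continuous_on_subset[OF contwv]) auto
    qed (use t w_bd lim_w in auto)
    then show ?thesis unfolding u_def u'_def primitive_from_def by (intro tendsto_intros lim_x)
  qed
  have delay_close: "\<bar>s - delay (\<delta> n) s\<bar> \<le> \<delta> n" if "s \<in> {0..T}" for s n
    using that \<delta>[of n] by (auto simp: delay_def)
  have lim_\<delta>k: "(\<lambda>n. \<delta> (k n)) \<longlonglongrightarrow> 0" using LIMSEQ_subseq_LIMSEQ[OF \<delta>0 k] by (simp add: o_def)
  \<comment> \<open>The Lipschitz constant is uniform in \<open>n\<close>, so moving the argument by
    at most \<open>\<delta> (k n)\<close> leaves the limit unchanged.\<close>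
  have lim_delay: "(\<lambda>n. q n (delay (\<delta> (k n)) s)) \<longlonglongrightarrow> l"
    if lim: "(\<lambda>n. q n s) \<longlonglongrightarrow> l" and s: "s \<in> {0..T}" and "0 \<le> K"
      and K: "\<And>n r. r \<in> {0..T} \<Longrightarrow> \<bar>q n s - q n r\<bar> \<le> K * \<bar>s - r\<bar>" for q :: "nat \<Rightarrow> real \<Rightarrow> real" and s l K
  proof -
    have "(\<lambda>n. q n s - q n (delay (\<delta> (k n)) s)) \<longlonglongrightarrow> 0"
    proof (rule Lim_null_comparison)
      show "\<forall>\<^sub>F n in sequentially. norm (q n s - q n (delay (\<delta> (k n)) s)) \<le> K * \<delta> (k n)"
      proof (intro always_eventually allI)
        fix n
        have "\<bar>q n s - q n (delay (\<delta> (k n)) s)\<bar> \<le> K * \<bar>s - delay (\<delta> (k n)) s\<bar>"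
          by (rule K[OF delay_in[OF s]])
        also have "\<dots> \<le> K * \<delta> (k n)" using delay_close[OF s] \<open>0 \<le> K\<close> by (intro mult_left_mono) auto
        finally show "norm (q n s - q n (delay (\<delta> (k n)) s)) \<le> K * \<delta> (k n)" by simp
      qed
      show "(\<lambda>n. K * \<delta> (k n)) \<longlonglongrightarrow> 0" using tendsto_mult_right_zero[OF lim_\<delta>k] by simp
    qed
    from tendsto_diff[OF lim this] show ?thesis by simp
  qed
  have u_lip: "\<bar>u n s - u n r\<bar> \<le> W * \<bar>s - r\<bar>" if "s \<in> {0..T}" "r \<in> {0..T}" for n s r
    using lip[OF contwv[of n] w_bd that(2,1)] by (simp add: u_def primitive_from_def)
  have f_lim: "(\<lambda>n. f s (p n) (q n)) \<longlonglongrightarrow> f s p' q'" if "s \<in> {0..T}" "p \<longlonglongrightarrow> p'" "q \<longlonglongrightarrow> q'" for s p q p' q'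
  proof -
    have "(\<lambda>n. (\<lambda>(t, x, y). f t x y) (s, p n, q n)) \<longlonglongrightarrow> (\<lambda>(t, x, y). f t x y) (s, p', q')"
      using that by (intro continuous_on_tendsto_compose[OF f] tendsto_intros) auto
    then show ?thesis by simp
  qed
  have lim_g: "(\<lambda>n. g (k n) (x (k n)) s) \<longlonglongrightarrow> f s (u' s) (\<psi> (v' s))" if s: "s \<in> {0..T}" for s
  proof -
    have "(\<lambda>n. u (k n) (delay (\<delta> (k n)) s)) \<longlonglongrightarrow> u' s"
      by (rule lim_delay[where q = "\<lambda>n. u (k n)", OF lim_u[OF s] s \<open>0 \<le> W\<close>]) (rule u_lip[OF s])
    moreover have "(\<lambda>n. v (k n) (delay (\<delta> (k n)) s)) \<longlonglongrightarrow> v' s"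
      by (rule lim_delay[where q = "\<lambda>n. v (k n)", OF lim_v[OF s] s \<open>0 \<le> H\<close>]) (unfold v_def, rule V_lip[OF _ s])
    ultimately have "(\<lambda>n. f s (u (k n) (delay (\<delta> (k n)) s)) (\<psi> (v (k n) (delay (\<delta> (k n)) s)))) \<longlonglongrightarrow> f s (u' s) (\<psi> (v' s))"
      by (intro f_lim s \<psi>_lim)
    then show ?thesis unfolding g_def u_def v_def .
  qed
  show thesis
  proof (rule that[OF v', of x'])
    show "\<forall>t\<in>{0..T}. v' t = \<phi> x' + integral {0..t} (\<lambda>s. f s (primitive_from x' (\<lambda>r. \<psi> (v' r)) s) (\<psi> (v' s)))"
    proof
      fix t assume t: "t \<in> {0..T}"
      have "(\<lambda>n. integral {0..t} (g (k n) (x (k n)))) \<longlonglongrightarrow> integral {0..t} (\<lambda>s. f s (u' s) (\<psi> (v' s)))"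
      proof (rule dominated_convergence(2)[where h = "\<lambda>r. H"])
        show "g (k n) (x (k n)) integrable_on {0..t}" for n
          using t by (intro integrable_continuous_real continuous_on_subset[OF contg]) auto
      qed (use t g_bd lim_g in auto)
      moreover have "(\<lambda>n. \<phi> (x (k n))) \<longlonglongrightarrow> \<phi> x'"
        using \<phi> lim_x by (rule continuous_on_tendsto_compose) auto
      ultimately have "(\<lambda>n. v (k n) t) \<longlonglongrightarrow> \<phi> x' + integral {0..t} (\<lambda>s. f s (u' s) (\<psi> (v' s)))"
        unfolding v_def V_g[OF t] by (intro tendsto_intros)
      from LIMSEQ_unique[OF lim_v[OF t] this]
      show "v' t = \<phi> x' + integral {0..t} (\<lambda>s. f s (primitive_from x' (\<lambda>r. \<psi> (v' r)) s) (\<psi> (v' s)))"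
        unfolding u'_def .
    qed
    have "(\<lambda>n. integral {0..T} (\<lambda>t. f t (u (k n) t) (\<psi> (v (k n) t)))) \<longlonglongrightarrow> integral {0..T} (\<lambda>t. f t (u' t) (\<psi> (v' t)))"
    proof (rule dominated_convergence(2)[where h = "\<lambda>r. H"])
      show "(\<lambda>t. f t (u (k n) t) (\<psi> (v (k n) t))) integrable_on {0..T}" for n
        unfolding u_def v_def
        by (intro integrable_continuous_real continuous_on_superposition[OF f] contw contu continuous_on_id) auto
    qed (use H f_lim lim_u lim_w in auto)
    moreover have "(\<lambda>n. B (x (k n))) \<longlonglongrightarrow> B x'"
      using B lim_x by (rule continuous_on_tendsto_compose) auto
    ultimately have "(\<lambda>n. E (x (k n)) (v (k n))) \<longlonglongrightarrow> E x' v'"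
      unfolding E_def u_def u'_def by (intro tendsto_intros)
    moreover have "E (x (k n)) (v (k n)) = 0" for n
      using x(2)[of "k n"] unfolding v_def[abs_def] by simp
    ultimately show "E x' v' = 0" by (simp add: LIMSEQ_const_iff)
  qed
qed

section \<open>Sign change along the diagonal\<close>

lemma has_deriv_on:
  assumes "0 < T" "u \<in> C1 T" "t \<in> {0..T}"
  shows "(u has_real_derivative deriv_on T u t) (at t within {0..T})"
  using assms unfolding C1_def differentiable_on_def deriv_on_def
  by (auto simp: has_real_derivative_iff_has_vector_derivative vector_derivative_works)

lemma deriv_on_eqI:
  assumes "0 < T" "t \<in> {0..T}" "(u has_real_derivative d) (at t within {0..T})"
  shows "deriv_on T u t = d"
  unfolding deriv_on_def using assms
  by (intro vector_derivative_within_cbox[where a = 0 and b = T, unfolded cbox_interval])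
    (auto simp: has_real_derivative_iff_has_vector_derivative)

lemma C1_I:
  assumes "0 < T" "continuous_on {0..T} w"
    and "\<And>t. t \<in> {0..T} \<Longrightarrow> (u has_real_derivative w t) (at t within {0..T})"
  shows "u \<in> C1 T"
proof -
  have "continuous_on {0..T} (deriv_on T u)"
    using assms(2) by (rule continuous_on_eq) (use assms deriv_on_eqI in metis)
  moreover have "u differentiable_on {0..T}"
    unfolding differentiable_on_def using assms(3) real_differentiable_def by blast
  ultimately show ?thesis by (simp add: C1_def)
qed

text \<open>If \<open>u\<close> satisfies the differential equation, the integral is
  \<open>\<phi> (u'(T)) - \<phi> (u'(0))\<close>. For injective \<open>\<phi>\<close>, a zero of the
  defect then expresses the condition \<open>u'(T) = b u'(0)\<close>.\<close>

definition defect ::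
  "real \<Rightarrow> real \<Rightarrow> (real \<Rightarrow> real) \<Rightarrow> (real \<Rightarrow> real \<Rightarrow> real \<Rightarrow> real) \<Rightarrow> (real \<Rightarrow> real) \<Rightarrow> real" where
  "defect T b \<phi> f u =
     integral {0..T} (\<lambda>t. f t (u t) (deriv_on T u t)) - B_map \<phi> b (deriv_on T u 0)"

lemma defect_eqI:
  assumes "0 < T" and "\<And>t. t \<in> {0..T} \<Longrightarrow> (u has_real_derivative w t) (at t within {0..T})"
  shows "defect T b \<phi> f u = integral {0..T} (\<lambda>t. f t (u t) (w t)) - B_map \<phi> b (w 0)"
proof -
  have "deriv_on T u t = w t" if "t \<in> {0..T}" for t
    using deriv_on_eqI[OF assms(1) that assms(2)[OF that]] .
  then have "integral {0..T} (\<lambda>t. f t (u t) (deriv_on T u t)) = integral {0..T} (\<lambda>t. f t (u t) (w t))"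
    and "deriv_on T u 0 = w 0"
    using assms(1) by (auto intro!: integral_cong)
  then show ?thesis by (simp add: defect_def)
qed

text \<open>The segment from \<open>u\<close> to \<open>v\<close> stays among functions with
  derivative in the convex set \<open>C\<close>. The defect is continuous along it and has no zero
  there, so its sign cannot change.\<close>

lemma defect_same_sign:
  assumes T: "0 < T" and \<phi>: "continuous_on UNIV \<phi>"
    and f: "continuous_on ({0..T} \<times> UNIV \<times> UNIV) (\<lambda>(t, x, y). f t x y)"
    and "convex C"
    and nz: "\<And>u. u \<in> C1 T \<Longrightarrow> (\<And>t. t \<in> {0..T} \<Longrightarrow> deriv_on T u t \<in> C) \<Longrightarrow> defect T b \<phi> f u \<noteq> 0"
    and u: "u \<in> C1 T" "\<And>t. t \<in> {0..T} \<Longrightarrow> deriv_on T u t \<in> C"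
    and v: "v \<in> C1 T" "\<And>t. t \<in> {0..T} \<Longrightarrow> deriv_on T v t \<in> C"
  shows "0 < defect T b \<phi> f u * defect T b \<phi> f v"
proof (rule ccontr)
  assume "\<not> ?thesis"
  let ?z = "\<lambda>s t. (1 - s) * u t + s * v t"
  let ?w = "\<lambda>s t. (1 - s) * deriv_on T u t + s * deriv_on T v t"
  have der: "(?z s has_real_derivative ?w s t) (at t within {0..T})" if "t \<in> {0..T}" for s t
    using has_deriv_on[OF T _ that] u(1) v(1) by (intro DERIV_add DERIV_cmult) auto
  have cont_u: "continuous_on {0..T} u" "continuous_on {0..T} v"
    using u(1) v(1) by (auto simp: C1_def intro: differentiable_imp_continuous_on)
  have cont_du: "continuous_on {0..T} (deriv_on T u)" "continuous_on {0..T} (deriv_on T v)"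
    using u(1) v(1) by (auto simp: C1_def)
  have C1: "?z s \<in> C1 T" for s
    by (rule C1_I[OF T _ der]) (intro continuous_intros cont_du)
  have nz': "defect T b \<phi> f (?z s) \<noteq> 0" if "s \<in> {0..1}" for s
  proof (rule nz[OF C1])
    fix t assume t: "t \<in> {0..T}"
    have "(1 - s) *\<^sub>R deriv_on T u t + s *\<^sub>R deriv_on T v t \<in> C"
      using \<open>convex C\<close> u(2)[OF t] v(2)[OF t] that by (intro convexD) auto
    then show "deriv_on T (?z s) t \<in> C"
      unfolding deriv_on_eqI[OF T t der[OF t]] by simp
  qed
  have eq: "defect T b \<phi> f (?z s) = integral (cbox 0 T) (\<lambda>t. f t (?z s t) (?w s t)) - B_map \<phi> b (?w s 0)" for s
    unfolding cbox_interval by (rule defect_eqI[OF T der])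
  have comp: "continuous_on ({0..1} \<times> cbox 0 T) (\<lambda>z. q (snd z))" if "continuous_on {0..T} q" for q :: "real \<Rightarrow> real"
    by (rule continuous_on_compose2[OF that]) (auto intro!: continuous_intros)
  have "continuous_on ({0..1} \<times> cbox 0 T) (\<lambda>(s, t). f t (?z s t) (?w s t))"
    unfolding split_beta
    by (intro continuous_on_superposition[OF f] continuous_intros comp cont_u cont_du) auto
  then have "continuous_on {0..1} (\<lambda>s. integral (cbox 0 T) (\<lambda>t. f t (?z s t) (?w s t)))"
    by (rule integral_continuous_on_param)
  moreover have "continuous_on {0..1} (\<lambda>s. B_map \<phi> b (?w s 0))"
    unfolding B_map_def by (intro continuous_intros continuous_on_compose2[OF \<phi>]) auto
  ultimately have "continuous_on {0..1} (\<lambda>s. defect T b \<phi> f (?z s))"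
    unfolding eq by (intro continuous_on_diff)
  from zero_of_sign_change[OF this] \<open>\<not> ?thesis\<close> nz' show False by auto
qed

section \<open>The affine ball and the degree condition\<close>

text \<open>The absolute value of an affine function is convex, so its maximum is attained at an
  endpoint of the interval.\<close>

lemma affine_ball_iff:
  assumes "0 < T"
  shows "z \<in> affine_ball T \<rho> \<longleftrightarrow> max \<bar>z $ 1\<bar> \<bar>z $ 1 + z $ 2 * T\<bar> + \<bar>z $ 2\<bar> < \<rho>"
proof -
  have "(SUP t\<in>{0..T}. \<bar>z $ 1 + z $ 2 * t\<bar>) = max \<bar>z $ 1\<bar> \<bar>z $ 1 + z $ 2 * T\<bar>"
  proof (rule cSup_eq_maximum)
    show "max \<bar>z $ 1\<bar> \<bar>z $ 1 + z $ 2 * T\<bar> \<in> (\<lambda>t. \<bar>z $ 1 + z $ 2 * t\<bar>) ` {0..T}"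
      using assms by (auto simp: max_def image_iff intro: bexI[of _ 0] bexI[of _ T])
    fix r assume "r \<in> (\<lambda>t. \<bar>z $ 1 + z $ 2 * t\<bar>) ` {0..T}"
    then obtain t where t: "0 \<le> t" "t \<le> T" "r = \<bar>z $ 1 + z $ 2 * t\<bar>" by auto
    have "z $ 2 * t \<in> closed_segment 0 (z $ 2 * T)"
      using t assms by (auto simp: in_segment intro!: exI[of _ "t / T"])
    then have "(0 \<le> z $ 2 * t \<and> z $ 2 * t \<le> z $ 2 * T) \<or> (z $ 2 * T \<le> z $ 2 * t \<and> z $ 2 * t \<le> 0)"
      by (auto simp: closed_segment_eq_real_ivl split: if_splits)
    then show "r \<le> max \<bar>z $ 1\<bar> \<bar>z $ 1 + z $ 2 * T\<bar>"
      using t(3) by linarith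
  qed
  then show ?thesis by (simp add: affine_ball_eq[OF assms])
qed

text \<open>The endpoint \<open>T\<close> dominates with \<open>\<bar>c\<bar> * (1 + T)\<close>, and
  the derivative contributes another \<open>\<bar>c\<bar>\<close>.\<close>

lemma affine_ball_diagonal:
  assumes "0 < T" "z $ 1 = c" "z $ 2 = c"
  shows "z \<in> affine_ball T \<rho> \<longleftrightarrow> \<bar>c\<bar> * (2 + T) < \<rho>"
proof -
  have "\<bar>c + c * T\<bar> = \<bar>c\<bar> * (1 + T)"
    using assms(1) abs_mult[of c "1 + T"] by (simp add: algebra_simps)
  moreover have "\<bar>c\<bar> \<le> \<bar>c\<bar> * (1 + T)" using assms(1) by (simp add: mult_le_cancel_left1)
  ultimately show ?thesis using assms
    by (simp add: affine_ball_iff max_def algebra_simps)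
qed

lemma open_affine_ball: "0 < T \<Longrightarrow> open (affine_ball T \<rho>)"
proof -
  assume T: "0 < T"
  have "open {z :: real ^ 2. max \<bar>z $ 1\<bar> \<bar>z $ 1 + z $ 2 * T\<bar> + \<bar>z $ 2\<bar> < \<rho>}"
    by (intro open_Collect_less continuous_intros)
  moreover have "affine_ball T \<rho> = {z. max \<bar>z $ 1\<bar> \<bar>z $ 1 + z $ 2 * T\<bar> + \<bar>z $ 2\<bar> < \<rho>}"
    using affine_ball_iff[OF T] by blast
  ultimately show ?thesis by simp
qed

lemma bounded_affine_ball: "0 < T \<Longrightarrow> bounded (affine_ball T \<rho>)"
proof (rule boundedI)
  fix z assume "0 < T" "z \<in> affine_ball T \<rho>"
  then have "max \<bar>z $ 1\<bar> \<bar>z $ 1 + z $ 2 * T\<bar> + \<bar>z $ 2\<bar> < \<rho>" using affine_ball_iff by blast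
  then have "\<bar>z $ 1\<bar> + \<bar>z $ 2\<bar> \<le> \<rho>" by linarith
  then show "norm z \<le> \<rho>" using norm_le_l1_cart[of z] by (simp add: sum_2)
qed

lemma continuous_on_G_map:
  assumes T: "0 < T" and \<phi>: "continuous_on UNIV \<phi>"
    and f: "continuous_on ({0..T} \<times> UNIV \<times> UNIV) (\<lambda>(t, x, y). f t x y)"
  shows "continuous_on S (G_map T b \<phi> f)"
proof -
  have "continuous_on (S \<times> cbox 0 T) (\<lambda>(z, t). f t (z $ 1 + z $ 2 * t) (z $ 2))"
    unfolding split_beta by (intro continuous_on_superposition[OF f] continuous_intros) auto
  then have "continuous_on S (\<lambda>z. integral (cbox 0 T) (\<lambda>t. f t (z $ 1 + z $ 2 * t) (z $ 2)))"
    by (rule integral_continuous_on_param)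
  moreover have "continuous_on S (\<lambda>z. B_map \<phi> b (z $ 1))"
    unfolding B_map_def by (intro continuous_intros continuous_on_compose2[OF \<phi>]) auto
  ultimately have "continuous_on S (\<lambda>z. (B_map \<phi> b (z $ 1) / T -
      1 / T * integral {0..T} (\<lambda>t. f t (z $ 1 + z $ 2 * t) (z $ 2))) *\<^sub>R axis 1 1 +
      (- z $ 1 + z $ 2) *\<^sub>R (axis 2 1 :: real ^ 2))"
    using T by (intro continuous_intros) auto
  then show ?thesis
    by (rule continuous_on_eq) (simp add: G_map_def vec_eq_iff forall_2 axis_def)
qed

text \<open>The second component of \<open>G_map\<close> vanishes only on the diagonal. Equal signs
  of the defect at \<open>M1\<close> and \<open>M2\<close> would fix the sign of the first component
  at all diagonal points outside the ball, so the boundary image would miss a half-line and admit a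
  continuous logarithm.\<close>

lemma sign_change_of_degree:
  fixes \<phi> :: "real \<Rightarrow> real"
  assumes T: "0 < T" and \<phi>: "continuous_on UNIV \<phi>"
    and f: "continuous_on ({0..T} \<times> UNIV \<times> UNIV) (\<lambda>(t, x, y). f t x y)"
    and \<rho>: "opportune_radius T b \<phi> f \<rho>"
    and deg: "brouwer_degree (G_map T b \<phi> f) (affine_ball T \<rho>) 0 \<noteq> 0"
    and nz2: "\<And>c. M2 \<le> c \<Longrightarrow> defect T b \<phi> f (\<lambda>t. c + c * t) \<noteq> 0"
    and nz1: "\<And>c. c \<le> M1 \<Longrightarrow> defect T b \<phi> f (\<lambda>t. c + c * t) \<noteq> 0"
  shows "defect T b \<phi> f (\<lambda>t. M1 + M1 * t) * defect T b \<phi> f (\<lambda>t. M2 + M2 * t) < 0"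
proof (rule ccontr)
  let ?G = "G_map T b \<phi> f" and ?\<Omega> = "affine_ball T \<rho>"
  define \<gamma> where "\<gamma> c = defect T b \<phi> f (\<lambda>t. c + c * t)" for c
  have \<gamma>_eq: "\<gamma> c = integral {0..T} (\<lambda>t. f t (c + c * t) c) - B_map \<phi> b c" for c
    unfolding \<gamma>_def by (rule defect_eqI[OF T]) (auto intro!: derivative_eq_intros)
  have G1: "?G z $ 1 = - \<gamma> c / T" if "z $ 1 = c" "z $ 2 = c" for z c
    using that by (simp add: G_map_def \<gamma>_eq diff_divide_distrib)
  have G2: "?G z $ 2 = z $ 2 - z $ 1" for z
    by (simp add: G_map_def)
  have cont_\<gamma>: "continuous_on S \<gamma>" for S
  proof -
    let ?d = "\<lambda>c :: real. c *\<^sub>R (1 :: real ^ 2)"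
    have "continuous_on S (\<lambda>c. ?G (?d c))"
      by (rule continuous_on_compose2[OF continuous_on_G_map[OF T \<phi> f, of UNIV]]) (auto intro!: continuous_intros)
    then have "continuous_on S (\<lambda>c. - T * (?G (?d c) $ 1))" by (intro continuous_intros)
    moreover have "- T * (?G (?d c) $ 1) = \<gamma> c" for c using T by (simp add: G1[of _ c])
    ultimately show ?thesis by simp
  qed
  have same_sign: "0 < \<gamma> x * \<gamma> y" if "x \<le> y" "\<And>c. x \<le> c \<Longrightarrow> c \<le> y \<Longrightarrow> \<gamma> c \<noteq> 0" for x y
    using zero_of_sign_change[OF cont_\<gamma> \<open>x \<le> y\<close>] that(2) by (meson atLeastAtMost_iff not_le)
  \<comment> \<open>A zero \<open>c\<close> of \<open>\<gamma>\<close> gives the zero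
    \<open>(c, c)\<close> of \<open>G_map\<close>, which an opportune radius confines to the
    ball.\<close>
  have outside: "\<gamma> c \<noteq> 0" if "\<rho> \<le> \<bar>c\<bar> * (2 + T)" for c
  proof
    assume "\<gamma> c = 0"
    let ?z = "c *\<^sub>R (1 :: real ^ 2)"
    have "?G ?z = 0" using \<open>\<gamma> c = 0\<close> G1[of ?z c] G2[of ?z] by (simp add: vec_eq_iff forall_2)
    then have "?z \<in> ?\<Omega>" using \<rho> by (auto simp: opportune_radius_def)
    then show False using that affine_ball_diagonal[OF T, of ?z c \<rho>] by simp
  qed
  assume "\<not> ?thesis"
  then have pos: "0 < \<gamma> M1 * \<gamma> M2"
    using nz1[of M1] nz2[of M2] by (auto simp: \<gamma>_def not_less less_le)
  have "\<rho> > 0" using \<rho> by (simp add: opportune_radius_def)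
  \<comment> \<open>Signs are carried outwards along two zero-free stretches that meet at
    \<open>?c\<close>: one from \<open>x\<close>, outside the ball, and one from \<open>M1\<close>
    or \<open>M2\<close>, by the nonvanishing hypotheses.\<close>
  have diagonal: "0 < \<gamma> x * \<gamma> M2" if "\<rho> \<le> \<bar>x\<bar> * (2 + T)" for x
  proof (cases "0 \<le> x")
    case True
    let ?c = "max x M2"
    have "0 < \<gamma> x * \<gamma> ?c"
    proof (rule same_sign)
      fix c assume "x \<le> c"
      then have "\<bar>x\<bar> * (2 + T) \<le> \<bar>c\<bar> * (2 + T)" using True T by (intro mult_right_mono) auto
      then show "\<gamma> c \<noteq> 0" using that by (intro outside) simp
    qed simp
    moreover have "0 < \<gamma> M2 * \<gamma> ?c" by (rule same_sign) (use nz2 in \<open>auto simp: \<gamma>_def\<close>)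
    ultimately show ?thesis by (auto simp: zero_less_mult_iff)
  next
    case False
    let ?c = "min x M1"
    have "0 < \<gamma> ?c * \<gamma> x"
    proof (rule same_sign)
      fix c assume "c \<le> x"
      then have "\<bar>x\<bar> * (2 + T) \<le> \<bar>c\<bar> * (2 + T)" using False T by (intro mult_right_mono) auto
      then show "\<gamma> c \<noteq> 0" using that by (intro outside) simp
    qed simp
    moreover have "0 < \<gamma> ?c * \<gamma> M1" by (rule same_sign) (use nz1 in \<open>auto simp: \<gamma>_def\<close>)
    ultimately show ?thesis using pos by (auto simp: zero_less_mult_iff)
  qed
  \<comment> \<open>The minus sign cancels the one in \<open>- \<gamma> c / T\<close>, so
    \<open>\<sigma>\<close> times the first component is positive at the diagonal points of the
    boundary.\<close>
  define \<sigma> where "\<sigma> = - sgn (\<gamma> M2)"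
  have \<sigma>: "\<sigma> * \<sigma> = 1" using pos by (auto simp: \<sigma>_def sgn_if)
  have boundary: "of_real \<sigma> * cplx (?G z) \<notin> \<real>\<^sub>\<le>\<^sub>0" if z: "z \<in> frontier ?\<Omega>" for z
  proof
    assume neg: "of_real \<sigma> * cplx (?G z) \<in> \<real>\<^sub>\<le>\<^sub>0"
    then have "\<sigma> * (?G z $ 2) = 0" "\<sigma> * (?G z $ 1) \<le> 0"
      by (auto simp: complex_nonpos_Reals_iff cplx_def)
    then have eq: "z $ 2 = z $ 1" using \<sigma> G2[of z] by auto
    have "z \<notin> ?\<Omega>" using z open_affine_ball[OF T] by (simp add: frontier_def interior_open)
    then have "\<rho> \<le> \<bar>z $ 1\<bar> * (2 + T)" using affine_ball_diagonal[OF T refl eq] by simp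
    then have "0 < \<gamma> (z $ 1) * \<gamma> M2" by (rule diagonal)
    then have "0 < sgn (\<gamma> M2) * \<gamma> (z $ 1)" by (auto simp: sgn_if zero_less_mult_iff)
    then have "0 < \<sigma> * (?G z $ 1)" using T by (simp add: G1[OF refl eq] \<sigma>_def)
    then show False using \<open>\<sigma> * (?G z $ 1) \<le> 0\<close> by simp
  qed
  have "brouwer_degree ?G ?\<Omega> 0 = 0"
  proof (rule brouwer_degree_eq_0[OF open_affine_ball[OF T] bounded_affine_ball[OF T] _ continuous_on_G_map[OF T \<phi> f]])
    have "0 \<in> ?\<Omega>" using \<open>\<rho> > 0\<close> by (simp add: affine_ball_iff[OF T])
    then show "?\<Omega> \<noteq> {}" by blast
    \<comment> \<open>Multiplication by \<open>\<sigma>\<close> moves the missed half-line to the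
      branch cut of \<open>Ln\<close>; the constant \<open>Ln (of_real \<sigma>)\<close> undoes it,
      as \<open>\<sigma> * \<sigma> = 1\<close>.\<close>
    show "continuous_on (frontier ?\<Omega>) (\<lambda>z. Ln (of_real \<sigma>) + Ln (of_real \<sigma> * cplx (?G z)))"
      by (intro continuous_intros continuous_on_G_map[OF T \<phi> f] boundary)
    show "cplx (?G z) = exp (Ln (of_real \<sigma>) + Ln (of_real \<sigma> * cplx (?G z)))" if "z \<in> frontier ?\<Omega>" for z
    proof -
      have "of_real \<sigma> * cplx (?G z) \<noteq> 0" using boundary[OF that] by force
      then have "exp (Ln (of_real \<sigma>) + Ln (of_real \<sigma> * cplx (?G z))) = of_real (\<sigma> * \<sigma>) * cplx (?G z)"
        by (auto simp: exp_add)
      then show ?thesis by (simp add: \<sigma>)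
    qed
  qed
  with deg show False by contradiction
qed

section \<open>Existence\<close>

text \<open>\<open>\<psi>\<close> is strictly monotone, and surjectivity of \<open>\<phi>\<close>
  provides points whose images lie beyond both \<open>\<phi> M1\<close> and \<open>\<phi> M2\<close>
  with margin \<open>\<bar>K\<bar>\<close>.\<close>

lemma real_homeomorphism_coercive:
  fixes \<phi> \<psi> :: "real \<Rightarrow> real"
  assumes hom: "homeomorphism UNIV UNIV \<phi> \<psi>"
  obtains a b where "a \<le> b" "\<And>v. \<bar>v - \<phi> a\<bar> \<le> K \<Longrightarrow> \<psi> v \<le> M1" "\<And>v. \<bar>v - \<phi> b\<bar> \<le> K \<Longrightarrow> M2 \<le> \<psi> v"
proof -
  have inv: "\<phi> (\<psi> y) = y" "\<psi> (\<phi> x) = x" for x y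
    using hom by (auto simp: homeomorphism_def)
  have inj: "inj_on \<psi> UNIV" by (metis inj_onI inv(1))
  have "continuous_on UNIV \<psi>" using hom by (simp add: homeomorphism_def)
  then have "strict_mono_on UNIV \<psi> \<or> strict_antimono_on UNIV \<psi>"
    using inj injective_eq_monotone_map[OF is_interval_univ] by blast
  then show thesis
  proof
    assume "strict_mono_on UNIV \<psi>"
    then have mono: "\<psi> v \<le> \<psi> w" if "v \<le> w" for v w
      using that by (metis UNIV_I order_le_less strict_mono_onD)
    \<comment> \<open>Taking the minimum and maximum over both images gives \<open>a \<le> b\<close>
      without an assumed order of \<open>M1\<close> and \<open>M2\<close>.\<close>
    let ?a = "min (\<phi> M1) (\<phi> M2) - \<bar>K\<bar>" and ?b = "max (\<phi> M1) (\<phi> M2) + \<bar>K\<bar>"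
    show thesis
    proof (rule that[of "\<psi> ?a" "\<psi> ?b"])
      show "\<psi> ?a \<le> \<psi> ?b" by (rule mono) auto
      show "\<psi> v \<le> M1" if "\<bar>v - \<phi> (\<psi> ?a)\<bar> \<le> K" for v
        using mono[of v "\<phi> M1"] that by (auto simp: inv)
      show "M2 \<le> \<psi> v" if "\<bar>v - \<phi> (\<psi> ?b)\<bar> \<le> K" for v
        using mono[of "\<phi> M2" v] that by (auto simp: inv)
    qed
  next
    assume "strict_antimono_on UNIV \<psi>"
    then have mono: "\<psi> w \<le> \<psi> v" if "v \<le> w" for v w
      using that by (metis UNIV_I order_le_less monotone_onD)
    \<comment> \<open>For decreasing \<open>\<psi>\<close> the two extremes exchange their
      roles.\<close>
    let ?b = "min (\<phi> M1) (\<phi> M2) - \<bar>K\<bar>" and ?a = "max (\<phi> M1) (\<phi> M2) + \<bar>K\<bar>"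
    show thesis
    proof (rule that[of "\<psi> ?a" "\<psi> ?b"])
      show "\<psi> ?a \<le> \<psi> ?b" by (rule mono) auto
      show "\<psi> v \<le> M1" if "\<bar>v - \<phi> (\<psi> ?a)\<bar> \<le> K" for v
        using mono[of "\<phi> M1" v] that by (auto simp: inv)
      show "M2 \<le> \<psi> v" if "\<bar>v - \<phi> (\<psi> ?b)\<bar> \<le> K" for v
        using mono[of v "\<phi> M2"] that by (auto simp: inv)
    qed
  qed
qed

lemma primitive_from_derivative:
  assumes "continuous_on {0..T} w" "t \<in> {0..T}"
  shows "(primitive_from x w has_real_derivative w t) (at t within {0..T})"
  using integral_has_real_derivative[OF assms] unfolding primitive_from_def
  by (auto intro!: derivative_eq_intros)

theorem theorem4p2:
  fixes T b \<rho> M1 M2 :: real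
    and \<phi> h :: "real \<Rightarrow> real"
    and f :: "real \<Rightarrow> real \<Rightarrow> real \<Rightarrow> real"
  assumes "0 < T" and "b \<noteq> 0"
    and "\<exists>\<psi>. homeomorphism UNIV UNIV \<phi> \<psi>" and "\<phi> 0 = 0"
    and "continuous_on ({0..T} \<times> UNIV \<times> UNIV) (\<lambda>(t, x, y). f t x y)"
    and "opportune_radius T b \<phi> f \<rho>"
    and "continuous_on {0..T} h"
    and "\<forall>t\<in>{0..T}. \<forall>x y. \<bar>f t x y\<bar> \<le> h t"
    and "M1 < M2"
    and "\<forall>u\<in>C1 T. (INF t\<in>{0..T}. deriv_on T u t) \<ge> M2 \<longrightarrow>
           integral {0..T} (\<lambda>t. f t (u t) (deriv_on T u t)) - B_map \<phi> b (deriv_on T u 0) \<noteq> 0"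
    and "\<forall>u\<in>C1 T. (SUP t\<in>{0..T}. deriv_on T u t) \<le> M1 \<longrightarrow>
           integral {0..T} (\<lambda>t. f t (u t) (deriv_on T u t)) - B_map \<phi> b (deriv_on T u 0) \<noteq> 0"
    and "brouwer_degree (G_map T b \<phi> f) (affine_ball T \<rho>) 0 \<noteq> 0"
  shows "\<exists>u. is_solution T b \<phi> f u"
proof -
  note T = \<open>0 < T\<close> and f = assms(5)
  obtain \<psi> where hom: "homeomorphism UNIV UNIV \<phi> \<psi>" using assms(3) by blast
  then have \<phi>: "continuous_on UNIV \<phi>" and \<psi>: "continuous_on UNIV \<psi>"
    and inv: "\<And>y. \<phi> (\<psi> y) = y" "\<And>x. \<psi> (\<phi> x) = x"
    by (auto simp: homeomorphism_def)
  let ?D = "defect T b \<phi> f"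
  obtain H where H: "\<bar>f t x y\<bar> \<le> H" if "t \<in> {0..T}" for t x y
  proof -
    obtain t0 where "\<forall>t\<in>{0..T}. h t \<le> h t0"
      using continuous_attains_sup[OF compact_Icc _ assms(7)] T by auto
    then show ?thesis using assms(8) that[of "h t0"] by (meson order_trans)
  qed
  have nz2: "?D u \<noteq> 0" if "u \<in> C1 T" "\<And>t. t \<in> {0..T} \<Longrightarrow> deriv_on T u t \<in> {M2..}" for u
  proof -
    have "M2 \<le> (INF t\<in>{0..T}. deriv_on T u t)"
      using that(2) T by (intro cINF_greatest) auto
    then show ?thesis using assms(10) that(1) by (simp add: defect_def)
  qed
  have nz1: "?D u \<noteq> 0" if "u \<in> C1 T" "\<And>t. t \<in> {0..T} \<Longrightarrow> deriv_on T u t \<in> {..M1}" for u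
  proof -
    have "(SUP t\<in>{0..T}. deriv_on T u t) \<le> M1"
      using that(2) T by (intro cSUP_least) auto
    then show ?thesis using assms(11) that(1) by (simp add: defect_def)
  qed
  have affine_der: "((\<lambda>t. c + c * t) has_real_derivative c) (at t within {0..T})" for c t
    by (auto intro!: derivative_eq_intros)
  have affine: "(\<lambda>t. c + c * t) \<in> C1 T" for c
    by (rule C1_I[OF T continuous_on_const affine_der])
  have affine_deriv: "deriv_on T (\<lambda>t. c + c * t) t = c" if "t \<in> {0..T}" for c t
    by (rule deriv_on_eqI[OF T that affine_der])
  have change: "?D (\<lambda>t. M1 + M1 * t) * ?D (\<lambda>t. M2 + M2 * t) < 0"
  proof (rule sign_change_of_degree[OF T \<phi> f assms(6,12)])
    show "?D (\<lambda>t. c + c * t) \<noteq> 0" if "M2 \<le> c" for c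
      by (rule nz2[OF affine]) (use that in \<open>simp add: affine_deriv\<close>)
    show "?D (\<lambda>t. c + c * t) \<noteq> 0" if "c \<le> M1" for c
      by (rule nz1[OF affine]) (use that in \<open>simp add: affine_deriv\<close>)
  qed
  \<comment> \<open>\<open>H * T\<close> bounds how far \<open>v\<close> can move from its initial
    value, so the derivative \<open>\<psi> (v t)\<close> stays in the required half-line on the
    whole interval.\<close>
  obtain x1 x2 where x: "x1 \<le> x2" and small: "\<And>v. \<bar>v - \<phi> x1\<bar> \<le> H * T \<Longrightarrow> \<psi> v \<le> M1"
    and large: "\<And>v. \<bar>v - \<phi> x2\<bar> \<le> H * T \<Longrightarrow> M2 \<le> \<psi> v"
    using real_homeomorphism_coercive[OF hom] by metis
  let ?u = "\<lambda>x v. primitive_from x (\<lambda>r. \<psi> (v r))"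
  have contw: "continuous_on {0..T} (\<lambda>t. \<psi> (v t))" if "continuous_on {0..T} v" for v
    by (rule continuous_on_compose2[OF \<psi> that]) simp
  have u_der: "(?u x v has_real_derivative \<psi> (v t)) (at t within {0..T})"
    if "continuous_on {0..T} v" "t \<in> {0..T}" for x v t
    by (rule primitive_from_derivative[OF contw[OF that(1)] that(2)])
  have u_C1: "?u x v \<in> C1 T" if "continuous_on {0..T} v" for x v
    by (rule C1_I[OF T contw[OF that] u_der[OF that]])
  have u_deriv: "deriv_on T (?u x v) t = \<psi> (v t)" if "continuous_on {0..T} v" "t \<in> {0..T}" for x v t
    by (rule deriv_on_eqI[OF T that(2) u_der[OF that]])
  have D_eq: "?D (?u x v) = integral {0..T} (\<lambda>t. f t (?u x v t) (\<psi> (v t))) - B_map \<phi> b (\<psi> (v 0))"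
    if "continuous_on {0..T} v" for x v
    by (rule defect_eqI[OF T u_der[OF that]])
  have B: "continuous_on UNIV (B_map \<phi> b)"
    unfolding B_map_def by (intro continuous_intros continuous_on_compose2[OF \<phi>]) auto
  obtain x v where v: "continuous_on {0..T} v"
    and zero: "integral {0..T} (\<lambda>t. f t (?u x v t) (\<psi> (v t))) - B_map \<phi> b x = 0"
    and v_eq: "\<forall>t\<in>{0..T}. v t = \<phi> x + integral {0..t} (\<lambda>s. f s (?u x v s) (\<psi> (v s)))"
  proof (rule shooting[OF T f H \<phi> \<psi> inv(2) B x])
    fix v v' assume v: "continuous_on {0..T} v" "v 0 = \<phi> x1" "\<And>t. t \<in> {0..T} \<Longrightarrow> \<bar>v t - \<phi> x1\<bar> \<le> H * T"
      and v': "continuous_on {0..T} v'" "v' 0 = \<phi> x2" "\<And>t. t \<in> {0..T} \<Longrightarrow> \<bar>v' t - \<phi> x2\<bar> \<le> H * T"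
    \<comment> \<open>The derivative stays at most \<open>M1\<close>, so this defect shares its sign
      with the affine function of slope \<open>M1\<close>. The same holds at \<open>M2\<close>, and
      the two affine signs are opposite.\<close>
    have "0 < ?D (?u x1 v) * ?D (\<lambda>t. M1 + M1 * t)"
      by (rule defect_same_sign[OF T \<phi> f convex_real_interval(2) nz1])
        (auto simp: u_deriv affine_deriv v intro!: u_C1 affine small)
    moreover have "0 < ?D (?u x2 v') * ?D (\<lambda>t. M2 + M2 * t)"
      by (rule defect_same_sign[OF T \<phi> f convex_real_interval(1) nz2])
        (auto simp: u_deriv affine_deriv v' intro!: u_C1 affine large)
    ultimately have "?D (?u x1 v) * ?D (?u x2 v') \<le> 0"
      using change by (auto simp: zero_less_mult_iff mult_less_0_iff mult_le_0_iff)
    then show "(integral {0..T} (\<lambda>t. f t (?u x1 v t) (\<psi> (v t))) - B_map \<phi> b x1) *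
        (integral {0..T} (\<lambda>t. f t (?u x2 v' t) (\<psi> (v' t))) - B_map \<phi> b x2) \<le> 0"
      using D_eq[OF v(1), of x1] D_eq[OF v'(1), of x2] by (simp add: v(2) v'(2) inv)
  qed blast
  let ?U = "?u x v"
  have v0: "v 0 = \<phi> x" using v_eq T by simp
  have "continuous_on {0..T} (\<lambda>t. f t (?U t) (\<psi> (v t)))"
    by (intro continuous_on_superposition[OF f] continuous_on_id contw v DERIV_continuous_on[OF u_der[OF v]])
  note contf = this
  \<comment> \<open>On the interval \<open>\<phi> (u')\<close> equals \<open>v\<close>, which the
    integral equation exhibits as a primitive of a continuous function.\<close>
  have \<phi>_der: "((\<lambda>t. \<phi> (deriv_on T ?U t)) has_real_derivative f t (?U t) (\<psi> (v t))) (at t within {0..T})"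
    if t: "t \<in> {0..T}" for t
    by (rule has_field_derivative_transform_within[OF primitive_from_derivative[OF contf t, of "\<phi> x"] zero_less_one t])
      (use v_eq in \<open>simp add: u_deriv[OF v] inv primitive_from_def\<close>)
  have "is_solution T b \<phi> f ?U"
    unfolding is_solution_def
  proof (intro conjI ballI)
    show "?U \<in> C1 T" by (rule u_C1[OF v])
    show "(\<lambda>t. \<phi> (deriv_on T ?U t)) \<in> C1 T" by (rule C1_I[OF T contf \<phi>_der])
    show "deriv_on T (\<lambda>s. \<phi> (deriv_on T ?U s)) t = f t (?U t) (deriv_on T ?U t)" if "t \<in> {0..T}" for t
      using deriv_on_eqI[OF T that \<phi>_der[OF that]] by (simp only: u_deriv[OF v that])
    have d0: "deriv_on T ?U 0 = x" using T by (simp add: u_deriv[OF v] v0 inv)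
    then show "deriv_on T ?U 0 = ?U 0" by (simp add: primitive_from_def)
    \<comment> \<open>The zero of the shooting functional says that the integral over the whole
      interval in \<open>v_eq\<close> is \<open>\<phi> (b * x) - \<phi> x\<close>.\<close>
    have "v T = \<phi> (b * x)" using v_eq zero T by (simp add: B_map_def)
    then show "deriv_on T ?U T = b * deriv_on T ?U 0"
      using T by (simp add: d0) (simp add: u_deriv[OF v] inv)
  qed
  then show ?thesis by blast
qed

end
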